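(* Let $u\in H(\mathbb D)$ and $\varphi\in S(\mathbb D)$. Then \[ \|uC_\varphi\|_{\mathcal B\to\mathcal B}\approx |u(0)|\log\frac{2}{1-|\varphi(0)|^2}+\sup_{a\in\mathbb D}\alpha(u,\varphi,a)+\sup_{a\in\mathbb D}\beta(u,\varphi,a), \] where \[ \alpha(u,\varphi,a)=|u(a)|\,\|\sigma_{\varphi(a)}\circ\varphi\circ\sigma_a\|_{A^2},\qquad \beta(u,\varphi,a)=\log\frac{2}{1-|\varphi(a)|^2}\,\|u\circ\sigma_a-u(a)\|_{A^2}. \]
   Context: $\mathbb D$ is the open unit disk, $H(\mathbb D)$ the analytic functions on $\mathbb D$, and $S(\mathbb D)$ the set of analytic self-maps of $\mathbb D$. For $a\in\mathbb D$, $\sigma_a(z)=\frac{a-z}{1-\bar a z}$. $dA=\frac1\pi\,dx\,dy$ is normalized area measure on $\mathbb D$, and $\|f\|_{A^p}=(\int_{\mathbb D}|f|^p\,dA)^{1/p}$. The Bloch space $\mathcal B$ consists of $f\in H(\mathbb D)$ with $\|f\|_\beta=\sup_{z\in\mathbb D}(1-|z|^2)|f'(z)|<\infty$, normed by $\|f\|_{\mathcal B}=|f(0)|+\|f\|_\beta$. The weighted composition operator is $(uC_\varphi f)(z)=u(z)f(\varphi(z))$, and $\|uC_\varphi\|_{\mathcal B\to\mathcal B}$ is its operator norm on $\mathcal B$ (possibly $+\infty$). The notation $X\approx Y$ means there are positive constants $c,C$ independent of $u$ and $\varphi$ with $cY\le X\le CY$ (so in particular one side is finite iff the other is). *)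

theory Defs
  imports "HOL-Analysis.Analysis"
begin

definition unit_disc :: "complex set" where
  "unit_disc = ball 0 1"

definition self_map :: "(complex \<Rightarrow> complex) \<Rightarrow> bool" where
  "self_map \<phi> \<longleftrightarrow> \<phi> holomorphic_on unit_disc \<and> \<phi> ` unit_disc \<subseteq> unit_disc"

definition disc_aut :: "complex \<Rightarrow> complex \<Rightarrow> complex" where
  "disc_aut a z = (a - z) / (1 - cnj a * z)"

text \<open>Bloch seminorm and norm, valued in ennreal (infinite iff f is not Bloch).\<close>
definition bloch_seminorm :: "(complex \<Rightarrow> complex) \<Rightarrow> ennreal" where
  "bloch_seminorm f = (SUP z\<in>unit_disc. ennreal ((1 - (cmod z)\<^sup>2) * cmod (deriv f z)))"

definition bloch_norm :: "(complex \<Rightarrow> complex) \<Rightarrow> ennreal" where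
  "bloch_norm f = ennreal (cmod (f 0)) + bloch_seminorm f"

definition wco_norm :: "(complex \<Rightarrow> complex) \<Rightarrow> (complex \<Rightarrow> complex) \<Rightarrow> ennreal" where
  "wco_norm u \<phi> = (SUP f\<in>{f. f holomorphic_on unit_disc \<and> bloch_norm f \<le> 1}.
      bloch_norm (\<lambda>z. u z * f (\<phi> z)))"

text \<open>Bergman A^2 norm with respect to normalized area measure dA = dx dy / pi.\<close>
definition A2_norm :: "(complex \<Rightarrow> complex) \<Rightarrow> ennreal" where
  "A2_norm g = (let I = (\<integral>\<^sup>+ z. indicator unit_disc z * ennreal ((cmod (g z))\<^sup>2 / pi) \<partial>lborel)
     in if I = \<infinity> then \<infinity> else ennreal (sqrt (enn2real I)))"

definition alpha_fn :: "(complex \<Rightarrow> complex) \<Rightarrow> (complex \<Rightarrow> complex) \<Rightarrow> complex \<Rightarrow> ennreal" where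
  "alpha_fn u \<phi> a = ennreal (cmod (u a)) * A2_norm (disc_aut (\<phi> a) \<circ> \<phi> \<circ> disc_aut a)"

definition beta_fn :: "(complex \<Rightarrow> complex) \<Rightarrow> (complex \<Rightarrow> complex) \<Rightarrow> complex \<Rightarrow> ennreal" where
  "beta_fn u \<phi> a = ennreal (ln (2 / (1 - (cmod (\<phi> a))\<^sup>2))) * A2_norm (\<lambda>z. u (disc_aut a z) - u a)"

end

theory Submission
  imports Defs "HOL-Complex_Analysis.Complex_Analysis"
begin

text \<open>
  The upper bound is the product rule for \<open>(u \<cdot> f \<circ> \<phi>)'\<close> combined with the growth of Bloch
  functions and with \<open>\<bar>g' 0\<bar> \<le> C \<parallel>g\<parallel>\<close> in \<open>A\<^sup>2\<close> for \<open>g 0 = 0\<close>, applied to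
  \<open>g = u \<circ> \<sigma>\<^sub>a - u a\<close> and \<open>g = \<sigma>\<^sub>b \<circ> \<phi> \<circ> \<sigma>\<^sub>a\<close> with \<open>b = \<phi> a\<close>.

  For the lower bound, a test function with value \<open>L b = log (2 / (1 - \<bar>b\<bar>\<^sup>2))\<close> and vanishing
  derivative at \<open>b\<close> bounds \<open>L (\<phi> a) (1 - \<bar>a\<bar>\<^sup>2) \<bar>u' a\<bar>\<close> pointwise.  By the Schwarz lemma
  \<open>L b\<close> exceeds \<open>L (\<phi> (\<sigma>\<^sub>a z))\<close> by at most a factor of order \<open>(1 - \<bar>z\<bar>)\<close> to the power
  \<open>-1/4\<close>, so integrating along radii gives a bound for \<open>L b \<bar>u (\<sigma>\<^sub>a z) - u a\<bar>\<close> by a square integrable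
  weight.  The \<open>\<alpha>\<close> term is treated in the same way, using the test functions \<open>1\<close> and \<open>\<sigma>\<^sub>b\<close>.
\<close>

section \<open>Point evaluation of the derivative on the Bergman space\<close>

lemma borel_measurable_Complex [measurable (raw)]:
  assumes [measurable]: "f \<in> borel_measurable M" "g \<in> borel_measurable M"
  shows "(\<lambda>x. Complex (f x) (g x)) \<in> borel_measurable M"
  unfolding Complex_eq by measurable

text \<open>\<open>lborel\<close> is determined by its values on boxes, and the preimage of a box
  under \<open>Complex\<close> is a product of two intervals. This opens the way to Fubini in either
  order of the coordinates.\<close>

lemma lborel_complex_eq_distr:
  "(lborel :: complex measure) = distr (lborel \<Otimes>\<^sub>M lborel) borel (\<lambda>p. Complex (fst p) (snd p))"
proof (rule lborel_eqI)
  fix l u :: complex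
  assume lu: "\<And>b. b \<in> Basis \<Longrightarrow> l \<bullet> b \<le> u \<bullet> b"
  have le: "Re l \<le> Re u" "Im l \<le> Im u"
    using lu[of 1] lu[of \<i>] by (auto simp: Basis_complex_def)
  have pre: "(\<lambda>p. Complex (fst p) (snd p)) -` box l u \<inter> space (lborel \<Otimes>\<^sub>M lborel)
      = {Re l<..<Re u} \<times> {Im l<..<Im u}"
    by (auto simp: in_box_complex_iff space_pair_measure)
  have "emeasure (distr (lborel \<Otimes>\<^sub>M lborel) borel (\<lambda>p. Complex (fst p) (snd p))) (box l u) =
      emeasure (lborel \<Otimes>\<^sub>M lborel) ({Re l<..<Re u} \<times> {Im l<..<Im u})"
    by (subst emeasure_distr) (auto simp: pre)
  then show "emeasure (distr (lborel \<Otimes>\<^sub>M lborel) borel (\<lambda>p. Complex (fst p) (snd p))) (box l u) =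
      ennreal (\<Prod>b\<in>Basis. (u - l) \<bullet> b)"
    using le by (simp add: lborel.emeasure_pair_measure_Times Basis_complex_def ennreal_mult)
qed simp

lemma nn_integral_lborel_complex:
  fixes f :: "complex \<Rightarrow> ennreal"
  assumes [measurable]: "f \<in> borel_measurable borel"
  shows "(\<integral>\<^sup>+z. f z \<partial>lborel) = (\<integral>\<^sup>+x. \<integral>\<^sup>+y. f (Complex x y) \<partial>lborel \<partial>lborel)"
    and "(\<integral>\<^sup>+z. f z \<partial>lborel) = (\<integral>\<^sup>+y. \<integral>\<^sup>+x. f (Complex x y) \<partial>lborel \<partial>lborel)"
proof -
  have *: "(\<integral>\<^sup>+z. f z \<partial>lborel) = (\<integral>\<^sup>+p. f (Complex (fst p) (snd p)) \<partial>(lborel \<Otimes>\<^sub>M lborel))"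
    by (subst lborel_complex_eq_distr, subst nn_integral_distr) auto
  show 1: "(\<integral>\<^sup>+z. f z \<partial>lborel) = (\<integral>\<^sup>+x. \<integral>\<^sup>+y. f (Complex x y) \<partial>lborel \<partial>lborel)"
    unfolding * by (subst lborel.nn_integral_fst[symmetric]) auto
  show "(\<integral>\<^sup>+z. f z \<partial>lborel) = (\<integral>\<^sup>+y. \<integral>\<^sup>+x. f (Complex x y) \<partial>lborel \<partial>lborel)"
    unfolding 1 by (rule lborel_pair.Fubini'[symmetric]) measurable
qed

text \<open>As \<open>d\<close> is a unit vector, \<open>y\<close> is signed arc length from the
  midpoint \<open>m\<close>. The bound is an ordinary integral over the real line, so it can later
  be integrated in \<open>s\<close> by Fubini.\<close>

lemma norm_contour_integral_linepath_le_nn_integral: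
  fixes m d :: complex and s :: real
  assumes s: "s > 0" and d: "cmod d = 1"
    and F: "continuous_on (closed_segment (m - of_real s * d) (m + of_real s * d)) F"
  shows "ennreal (cmod (contour_integral (linepath (m - of_real s * d) (m + of_real s * d)) F))
    \<le> (\<integral>\<^sup>+y. ennreal (cmod (F (m + of_real y * d))) * indicator {-s..s} y \<partial>lborel)"
proof -
  define \<gamma> where "\<gamma> = linepath (m - of_real s * d) (m + of_real s * d)"
  \<comment> \<open>Arc length is \<open>y = -s + 2 * s * t\<close>; the derivative
    \<open>2 * s\<close> of this substitution is the factor in \<open>E\<close>.\<close>
  have \<gamma>: "\<gamma> t = m + of_real (-s + 2 * s * t) * d" for t
    by (simp add: \<gamma>_def linepath_def scaleR_conv_of_real algebra_simps)
  define E where "E = (\<lambda>t. F (\<gamma> t) * (of_real (2 * s) * d))"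
  have "continuous_on {0..1} (\<lambda>t. F (\<gamma> t))"
  proof (rule continuous_on_compose2[OF F])
    show "continuous_on {0..1} \<gamma>" unfolding \<gamma>_def by (rule continuous_on_linepath)
    show "\<gamma> ` {0..1} \<subseteq> closed_segment (m - of_real s * d) (m + of_real s * d)"
      by (auto simp: \<gamma>_def linepath_in_path)
  qed
  then have E: "continuous_on {0..1} E"
    unfolding E_def by (intro continuous_intros)
  then have int: "set_integrable lborel {0..1} E"
    by (intro borel_integrable_atLeastAtMost') auto
  define K where "K = (\<lambda>y. ennreal (cmod (F (m + of_real y * d))) * indicator {-s..s} y)"
  have "continuous_on {-s..s} (\<lambda>y. cmod (F (m + of_real y * d)))"
  proof (intro continuous_on_norm continuous_on_compose2[OF F] continuous_intros image_subsetI)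
    fix y assume y: "y \<in> {-s..s}"
    have "m + of_real y * d = \<gamma> ((y + s) / (2 * s))"
      using s by (simp add: \<gamma> field_simps)
    moreover have "(y + s) / (2 * s) \<in> {0..1}" using s y by (auto simp: field_simps)
    ultimately show "m + of_real y * d \<in> closed_segment (m - of_real s * d) (m + of_real s * d)"
      by (metis \<gamma>_def linepath_in_path)
  qed
  then have "(\<lambda>y. ennreal (indicator {-s..s} y *\<^sub>R cmod (F (m + of_real y * d)))) \<in> borel_measurable borel"
    by (intro measurable_compose[OF borel_measurable_continuous_on_indicator]) auto
  also have "(\<lambda>y. ennreal (indicator {-s..s} y *\<^sub>R cmod (F (m + of_real y * d)))) = K"
    by (auto simp: K_def indicator_def)
  finally have K[measurable]: "K \<in> borel_measurable borel" .
  have "contour_integral \<gamma> F = integral {0..1} E"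
    unfolding \<gamma>_def contour_integral_integral E_def
    by (intro integral_cong) (simp add: vector_derivative_linepath_within vector_derivative_linepath_at)
  also have "\<dots> = (LINT t:{0..1}|lborel. E t)"
    using set_borel_integral_eq_integral(2)[OF int] by simp
  finally have "ennreal (cmod (contour_integral \<gamma> F))
      \<le> (\<integral>\<^sup>+t. ennreal (norm (indicator {0..1} t *\<^sub>R E t)) \<partial>lborel)"
    using integral_norm_bound_ennreal[OF int[unfolded set_integrable_def]]
    by (simp add: set_lebesgue_integral_def)
  also have "\<dots> = (\<integral>\<^sup>+t. ennreal (2 * s) * K (-s + 2 * s * t) \<partial>lborel)"
    using s d unfolding K_def
    by (intro nn_integral_cong)
      (auto simp: E_def \<gamma> norm_mult indicator_def ennreal_mult'[symmetric] mult_ac zero_le_mult_iff)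
  also have "\<dots> = (\<integral>\<^sup>+y. K y \<partial>lborel)"
    using s by (subst nn_integral_real_affine[OF K, of "2 * s" "-s"]) (auto simp: nn_integral_cmult)
  finally show ?thesis by (simp add: \<gamma>_def K_def)
qed

lemma nn_integral_lborel_reflect:
  assumes "f \<in> borel_measurable borel"
  shows "(\<integral>\<^sup>+x. f (- x) \<partial>lborel) = (\<integral>\<^sup>+x. f (x :: real) \<partial>lborel)"
  using nn_integral_real_affine[OF assms, of "-1" 0] by simp

text \<open>Cauchy's formula for \<open>(g z / z)\<^sup>2\<close> on the boundaries of the squares with half side \<open>s\<close>,
  averaged over \<open>s \<in> [1/4, 1/2]\<close>; squares reduce the average to Fubini in Cartesian coordinates.\<close>

lemma norm_deriv_0_le_nn_integral:
  assumes g: "g holomorphic_on unit_disc" and g0: "g 0 = 0"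
  shows "ennreal ((cmod (deriv g 0))\<^sup>2)
    \<le> 512 * (\<integral>\<^sup>+z. indicator unit_disc z * ennreal ((cmod (g z))\<^sup>2 / pi) \<partial>lborel)"
proof -
  \<comment> \<open>The quotient \<open>g z / z\<close> with its removable singularity at 0 filled
    in.\<close>
  define k where "k = (\<lambda>z. if z = 0 then deriv g 0 else g z / z)"
  have "(\<lambda>z. if z = 0 then deriv g 0 else (g z - g 0) / (z - 0)) holomorphic_on unit_disc"
    using g by (intro pole_lemma_open) (auto simp: unit_disc_def)
  also have "(\<lambda>z. if z = 0 then deriv g 0 else (g z - g 0) / (z - 0)) = k"
    by (auto simp: k_def g0)
  finally have k: "k holomorphic_on unit_disc" .
  \<comment> \<open>Squaring \<open>k\<close> before applying Cauchy's formula at 0 produces the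
    square of \<open>g\<close>, as in the area integral.\<close>
  define F where "F = (\<lambda>w. (k w)\<^sup>2 / (w - 0))"
  have F: "continuous_on (unit_disc - {0}) F"
    unfolding F_def
    by (intro continuous_intros holomorphic_on_imp_continuous_on holomorphic_on_subset[OF k]) auto
  define q where "q = (\<lambda>z. indicator unit_disc z * ennreal ((cmod (g z))\<^sup>2 / pi))"
  have "(\<lambda>z. ennreal (indicator unit_disc z *\<^sub>R ((cmod (g z))\<^sup>2 / pi))) \<in> borel_measurable borel"
    by (intro measurable_compose[OF borel_measurable_continuous_on_indicator]
        continuous_intros holomorphic_on_imp_continuous_on[OF g]) (auto simp: unit_disc_def)
  also have "(\<lambda>z. ennreal (indicator unit_disc z *\<^sub>R ((cmod (g z))\<^sup>2 / pi))) = q"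
    by (auto simp: q_def indicator_def)
  finally have q[measurable]: "q \<in> borel_measurable borel" .
  define I where "I = (\<integral>\<^sup>+z. q z \<partial>lborel)"
  \<comment> \<open>For \<open>d\<close> equal to 1, \<open>\<i>\<close>, -1 and
    \<open>-\<i>\<close> the points \<open>d * Complex y (- s)\<close> run along the bottom, right,
    top and left side of the square. The integral extends over the whole line; \<open>q\<close>
    vanishes off the disc.\<close>
  define J where "J = (\<lambda>d s. \<integral>\<^sup>+y. q (d * Complex y (- s)) \<partial>lborel)"
  have J_meas[measurable]: "J d \<in> borel_measurable borel" for d
    unfolding J_def by measurable
  \<comment> \<open>As \<open>s\<close> runs over the reals, each of the four lines sweeps the whole
    plane once, so all four integrals equal \<open>I\<close>.\<close>
  have J1: "(\<integral>\<^sup>+s. J 1 s \<partial>lborel) = I"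
  proof -
    have "(\<integral>\<^sup>+s. J 1 s \<partial>lborel) = (\<integral>\<^sup>+s. \<integral>\<^sup>+y. q (Complex y (- s)) \<partial>lborel \<partial>lborel)"
      by (simp add: J_def)
    also have "\<dots> = I"
      unfolding I_def nn_integral_lborel_complex(2)[OF q]
      by (rule nn_integral_lborel_reflect) measurable
    finally show ?thesis .
  qed
  have J2: "(\<integral>\<^sup>+s. J \<i> s \<partial>lborel) = I"
    unfolding I_def nn_integral_lborel_complex(1)[OF q] J_def by (simp add: complex_eq_iff i_mult_Complex)
  have J3: "(\<integral>\<^sup>+s. J (-1) s \<partial>lborel) = I"
  proof -
    have "J (-1) s = (\<integral>\<^sup>+y. q (Complex y s) \<partial>lborel)" for s
      using nn_integral_lborel_reflect[of "\<lambda>y. q (Complex y s)"] by (simp add: J_def complex_minus)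
    then show ?thesis by (simp add: I_def nn_integral_lborel_complex(2)[OF q])
  qed
  have J4: "(\<integral>\<^sup>+s. J (-\<i>) s \<partial>lborel) = I"
  proof -
    have "J (-\<i>) s = (\<integral>\<^sup>+y. q (Complex (- s) y) \<partial>lborel)" for s
      using nn_integral_lborel_reflect[of "\<lambda>y. q (Complex (- s) y)"] by (simp add: J_def i_mult_Complex complex_minus)
    then have "(\<integral>\<^sup>+s. J (-\<i>) s \<partial>lborel) = (\<integral>\<^sup>+s. \<integral>\<^sup>+y. q (Complex (- s) y) \<partial>lborel \<partial>lborel)"
      by simp
    also have "\<dots> = I"
      unfolding I_def nn_integral_lborel_complex(1)[OF q]
      by (rule nn_integral_lborel_reflect) measurable
    finally show ?thesis .
  qed
  \<comment> \<open>For these \<open>s\<close> the boundary of the square stays in the disc and has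
    distance at least 1/4 from 0.\<close>
  have key: "ennreal ((cmod (deriv g 0))\<^sup>2) \<le> 32 * (J 1 s + J \<i> s + J (-1) s + J (-\<i>) s)"
    if s: "s \<in> {1/4..1/2}" for s :: real
  proof -
    have s0: "s > 0" using s by auto
    have pt: "d * Complex y (- s) \<in> unit_disc - {0}" "cmod (d * Complex y (- s)) \<ge> 1/4"
      if "cmod d = 1" "\<bar>y\<bar> \<le> s" for d y
    proof -
      have "y\<^sup>2 \<le> s\<^sup>2" using abs_le_square_iff[of y s] that s0 by simp
      moreover have "s\<^sup>2 \<le> (1/2)\<^sup>2" "(1/4)\<^sup>2 \<le> s\<^sup>2" using s by (intro power_mono; simp)+
      then have "s\<^sup>2 \<le> 1/4" "1/16 \<le> s\<^sup>2" by (auto simp: power_divide)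
      ultimately have *: "y\<^sup>2 + s\<^sup>2 < 1" "1/16 \<le> y\<^sup>2 + s\<^sup>2"
        using zero_le_power2[of y] by linarith+
      have n: "cmod (d * Complex y (- s)) = sqrt (y\<^sup>2 + s\<^sup>2)"
        unfolding norm_mult that(1) by (simp add: complex_norm)
      show 14: "cmod (d * Complex y (- s)) \<ge> 1/4"
        unfolding n using * by (intro real_le_rsqrt) (simp add: power_divide)
      have "d * Complex y (- s) \<noteq> 0" using 14 by (metis norm_zero not_one_le_zero zero_less_divide_1_iff not_le zero_less_numeral)
      then show "d * Complex y (- s) \<in> unit_disc - {0}"
        using * n by (simp add: unit_disc_def)
    qed
    define P where "P = (\<lambda>d. linepath (d * Complex (- s) (- s)) (d * Complex s (- s)))"
    have seg: "closed_segment (d * Complex (- s) (- s)) (d * Complex s (- s)) \<subseteq> unit_disc - {0}"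
      if "cmod d = 1" for d
    proof
      fix w assume "w \<in> closed_segment (d * Complex (- s) (- s)) (d * Complex s (- s))"
      then obtain t where t: "0 \<le> t" "t \<le> 1"
        and w: "w = (1 - t) *\<^sub>R (d * Complex (- s) (- s)) + t *\<^sub>R (d * Complex s (- s))"
        by (auto simp: closed_segment_def)
      have "w = d * Complex (s * (2 * t - 1)) (- s)"
        unfolding w by (simp add: complex_eq_iff algebra_simps)
      moreover have "\<bar>s * (2 * t - 1)\<bar> \<le> s"
        using t s0 by (auto simp: abs_mult intro!: mult_left_le)
      ultimately show "w \<in> unit_disc - {0}" using pt(1)[OF that] by simp
    qed
    have integ: "F contour_integrable_on P d" if "cmod d = 1" for d
      unfolding P_def
      by (intro contour_integrable_continuous_linepath continuous_on_subset[OF F] seg that)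
    have rect: "rectpath (Complex (- s) (- s)) (Complex s s) = P 1 +++ P \<i> +++ P (-1) +++ P (-\<i>)"
      by (simp add: rectpath_def Let_def P_def i_mult_Complex complex_minus)
    have "(F has_contour_integral
       (2 * pi * \<i> * winding_number (rectpath (Complex (- s) (- s)) (Complex s s)) 0 * (k 0)\<^sup>2))
       (rectpath (Complex (- s) (- s)) (Complex s s))"
      unfolding F_def
    proof (rule Cauchy_integral_formula_convex_simple)
      show "path_image (rectpath (Complex (- s) (- s)) (Complex s s)) \<subseteq> unit_disc - {0}"
        unfolding rect
        by (intro order.trans[OF path_image_join_subset] Un_least;
            unfold P_def path_image_linepath; rule seg; simp)
      show "0 \<in> interior unit_disc" by (simp add: unit_disc_def interior_open)
    qed (use k in \<open>auto simp: unit_disc_def rectpath_def Let_def intro!: holomorphic_intros\<close>)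
    also have "winding_number (rectpath (Complex (- s) (- s)) (Complex s s)) 0 = 1"
      using s0 by (intro winding_number_rectpath) (auto simp: in_box_complex_iff)
    finally have "contour_integral (P 1 +++ P \<i> +++ P (-1) +++ P (-\<i>)) F = 2 * pi * \<i> * (k 0)\<^sup>2"
      unfolding rect by (simp add: contour_integral_unique)
    also have "contour_integral (P 1 +++ P \<i> +++ P (-1) +++ P (-\<i>)) F =
        contour_integral (P 1) F + (contour_integral (P \<i>) F
          + (contour_integral (P (-1)) F + contour_integral (P (-\<i>)) F))"
      using integ[of 1] integ[of \<i>] integ[of "-1"] integ[of "-\<i>"]
      by (simp add: contour_integral_join contour_integrable_joinI valid_path_join P_def
          i_mult_Complex complex_minus)
    finally have eq: "2 * pi * \<i> * (k 0)\<^sup>2 = \<dots>" ..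
    have side: "ennreal (cmod (contour_integral (P d) F)) \<le> ennreal (64 * pi) * J d s"
      if d: "cmod d = 1" for d
    proof -
      have ends: "d * Complex (- s) (- s) = - \<i> * of_real s * d - of_real s * d"
        "d * Complex s (- s) = - \<i> * of_real s * d + of_real s * d"
        by (auto simp: complex_eq_iff)
      have pe: "- \<i> * of_real s * d + of_real y * d = d * Complex y (- s)" for y
        by (auto simp: complex_eq_iff)
      have "ennreal (cmod (contour_integral (P d) F))
        \<le> (\<integral>\<^sup>+y. ennreal (cmod (F (d * Complex y (- s)))) * indicator {-s..s} y \<partial>lborel)"
        using norm_contour_integral_linepath_le_nn_integral[OF s0 d, of "- \<i> * of_real s * d" F]
          continuous_on_subset[OF F seg[OF d]]
        unfolding ends[symmetric] pe P_def by blast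
      also have "\<dots> \<le> (\<integral>\<^sup>+y. ennreal (64 * pi) * q (d * Complex y (- s)) \<partial>lborel)"
      proof (rule nn_integral_mono)
        fix y :: real
        let ?w = "d * Complex y (- s)"
        show "ennreal (cmod (F ?w)) * indicator {-s..s} y \<le> ennreal (64 * pi) * q ?w"
        proof (cases "\<bar>y\<bar> \<le> s")
          case True
          note w = pt[OF d True]
          \<comment> \<open>Cauchy's kernel contributes one factor \<open>1 / cmod ?w\<close> and
            \<open>k\<close> squared contributes two. With modulus at least 1/4 they give 64, while
            \<open>pi\<close> undoes the normalization in \<open>q\<close>.\<close>
          have "cmod (F ?w) = (cmod (g ?w))\<^sup>2 / cmod ?w ^ 3"
            using w(1) by (simp add: F_def k_def norm_divide norm_mult norm_power power_divide power2_eq_square power3_eq_cube)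
          also have "\<dots> \<le> (cmod (g ?w))\<^sup>2 / (1/4) ^ 3"
            using w(2) by (intro divide_left_mono power_mono mult_pos_pos zero_less_power) auto
          finally show ?thesis
            using w(1) True
            by (auto simp: q_def indicator_def ennreal_mult'[symmetric] power_divide intro!: ennreal_leI)
        qed (auto simp: indicator_def)
      qed
      also have "\<dots> = ennreal (64 * pi) * J d s"
        unfolding J_def by (rule nn_integral_cmult) measurable
      finally show ?thesis .
    qed
    have "ennreal (2 * pi * (cmod (k 0))\<^sup>2) = ennreal (cmod (2 * pi * \<i> * (k 0)\<^sup>2))"
      by (simp add: norm_mult norm_power)
    also have "\<dots> \<le> ennreal (cmod (contour_integral (P 1) F) + cmod (contour_integral (P \<i>) F)
          + cmod (contour_integral (P (-1)) F) + cmod (contour_integral (P (-\<i>)) F))"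
      unfolding eq by (intro ennreal_leI) (smt (verit) norm_triangle_ineq)
    also have "\<dots> = ennreal (cmod (contour_integral (P 1) F)) + ennreal (cmod (contour_integral (P \<i>) F))
          + ennreal (cmod (contour_integral (P (-1)) F)) + ennreal (cmod (contour_integral (P (-\<i>)) F))"
      by simp
    also have "\<dots> \<le> ennreal (64 * pi) * J 1 s + ennreal (64 * pi) * J \<i> s
        + ennreal (64 * pi) * J (-1) s + ennreal (64 * pi) * J (-\<i>) s"
      by (intro add_mono side) auto
    also have "\<dots> = ennreal (64 * pi) * (J 1 s + J \<i> s + J (-1) s + J (-\<i>) s)"
      by (simp add: distrib_left)
    \<comment> \<open>Dividing by the factor \<open>2 * pi\<close> of Cauchy's formula turns
      \<open>64 * pi\<close> into 32.\<close>
    finally have "ennreal (1 / (2 * pi)) * ennreal (2 * pi * (cmod (k 0))\<^sup>2)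
        \<le> ennreal (1 / (2 * pi)) * (ennreal (64 * pi) * (J 1 s + J \<i> s + J (-1) s + J (-\<i>) s))"
      by (rule mult_left_mono) auto
    then show ?thesis
      by (simp add: mult.assoc[symmetric] ennreal_mult'[symmetric] k_def)
  qed
  \<comment> \<open>The interval of admissible \<open>s\<close> has length 1/4. Four sides with
    factor 32 give \<open>128 * I\<close>, which becomes \<open>512 * I\<close> after clearing
    1/4.\<close>
  have "ennreal ((cmod (deriv g 0))\<^sup>2) * ennreal (1/4) =
      (\<integral>\<^sup>+s. ennreal ((cmod (deriv g 0))\<^sup>2) * indicator {1/4..1/2::real} s \<partial>lborel)"
    by (simp add: nn_integral_cmult_indicator)
  also have "\<dots> \<le> (\<integral>\<^sup>+s. 32 * (J 1 s + J \<i> s + J (-1) s + J (-\<i>) s) \<partial>lborel)"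
    using key by (intro nn_integral_mono) (auto simp: indicator_def)
  also have "\<dots> = 32 * (I + I + I + I)"
    by (simp add: nn_integral_cmult nn_integral_add J1 J2 J3 J4)
  also have "\<dots> = 128 * I"
  proof -
    have "32 * (I + I + I + I) = (32 + 32 + 32 + 32) * I"
      by (simp only: distrib_left distrib_right)
    then show ?thesis by simp
  qed
  finally have "4 * (ennreal ((cmod (deriv g 0))\<^sup>2) * ennreal (1/4)) \<le> 4 * (128 * I)"
    by (rule mult_left_mono) auto
  moreover have "4 * (ennreal ((cmod (deriv g 0))\<^sup>2) * ennreal (1/4)) = ennreal ((cmod (deriv g 0))\<^sup>2)"
    by (simp add: ennreal_mult'[symmetric] mult.left_commute flip: ennreal_numeral)
  ultimately show ?thesis
    by (simp add: I_def q_def mult.assoc[symmetric])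
qed

section \<open>From the area integral to \<open>A2_norm\<close>\<close>

lemma A2_norm_le:
  assumes "(\<integral>\<^sup>+z. indicator unit_disc z * ennreal ((cmod (g z))\<^sup>2 / pi) \<partial>lborel) \<le> ennreal (K\<^sup>2)"
    and "0 \<le> K"
  shows "A2_norm g \<le> ennreal K"
proof -
  define I where "I = (\<integral>\<^sup>+z. indicator unit_disc z * ennreal ((cmod (g z))\<^sup>2 / pi) \<partial>lborel)"
  have I: "I \<le> ennreal (K\<^sup>2)" using assms(1) by (simp add: I_def)
  \<comment> \<open>Finiteness selects the square-root branch in the definition of
    \<open>A2_norm\<close>.\<close>
  then have "I \<noteq> \<infinity>" using neq_top_trans[OF ennreal_neq_top I] by simp
  moreover have "enn2real I \<le> K\<^sup>2" using enn2real_mono[OF I] by simp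
  ultimately show ?thesis
    using assms(2) by (auto simp: A2_norm_def Let_def I_def[symmetric] intro!: ennreal_leI real_le_lsqrt)
qed

lemma norm_deriv_0_le_A2_norm:
  assumes "g holomorphic_on unit_disc" "g 0 = 0"
  shows "ennreal (cmod (deriv g 0)) \<le> 23 * A2_norm g"
proof -
  define I where "I = (\<integral>\<^sup>+z. indicator unit_disc z * ennreal ((cmod (g z))\<^sup>2 / pi) \<partial>lborel)"
  have I: "ennreal ((cmod (deriv g 0))\<^sup>2) \<le> 512 * I"
    using norm_deriv_0_le_nn_integral[OF assms] by (simp add: I_def)
  show ?thesis
  proof (cases "I = \<infinity>")
    case True
    then show ?thesis by (simp add: A2_norm_def Let_def I_def[symmetric] ennreal_mult_top)
  next
    case False
    then obtain i where i: "I = ennreal i" "i \<ge> 0"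
      by (cases I) auto
    have "ennreal ((cmod (deriv g 0))\<^sup>2) \<le> ennreal (512 * i)"
      using I i(2) unfolding i(1) by (subst ennreal_mult) auto
    then have "(cmod (deriv g 0))\<^sup>2 \<le> 512 * i" using i(2) by (simp add: ennreal_le_iff)
    \<comment> \<open>23 is the least integer whose square, 529, is at least 512.\<close>
    also have "\<dots> \<le> (23 * sqrt i)\<^sup>2" using i(2) by (simp add: power_mult_distrib)
    finally have "cmod (deriv g 0) \<le> 23 * sqrt i"
      by (rule power2_le_imp_le) (use i(2) in simp)
    then have "ennreal (cmod (deriv g 0)) \<le> ennreal (23 * sqrt i)" by (rule ennreal_leI)
    also have "\<dots> = 23 * ennreal (sqrt i)"
      using i(2) by (subst ennreal_mult) auto
    also have "ennreal (sqrt i) = A2_norm g"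
      unfolding A2_norm_def Let_def I_def[symmetric] i(1) using i(2) by simp
    finally show ?thesis .
  qed
qed

section \<open>Radial growth and square integrability\<close>

lemma emeasure_unit_disc_Diff_ball:
  assumes "0 \<le> r" "r \<le> 1"
  shows "emeasure lborel (unit_disc - ball 0 r) = ennreal (pi * (1 - r\<^sup>2))"
proof -
  have "emeasure lborel (unit_disc - ball 0 r) = emeasure lborel unit_disc - emeasure lborel (ball (0::complex) r)"
    using assms emeasure_lborel_ball_finite[of "0::complex" r]
    by (intro emeasure_Diff) (auto simp: unit_disc_def)
  also have "\<dots> = ennreal (pi * (1 - r\<^sup>2))"
    using assms by (simp add: unit_disc_def emeasure_ball unit_ball_vol_2 ennreal_minus algebra_simps)
  finally show ?thesis .
qed

text \<open>Decomposition into annuli \<open>S n\<close> of width \<open>1 / 4 ^ n\<close> at the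
  boundary. Their area is at most \<open>2 * pi / 4 ^ n\<close>, and the weight is charged
  \<open>2 ^ (n + 1) / pi\<close> there, so the sum is dominated by the geometric series of
  \<open>4 * (1/2) ^ n\<close>.\<close>

lemma nn_integral_inverse_sqrt_unit_disc:
  "(\<integral>\<^sup>+z. indicator unit_disc z * ennreal (1 / sqrt (1 - cmod z) / pi) \<partial>lborel) \<le> 8"
proof -
  have four: "4 ^ m = (2 ^ m :: real)\<^sup>2" for m
    by (simp add: power2_eq_square flip: power_mult_distrib)
  define S where "S = (\<lambda>n. unit_disc - ball (0::complex) (1 - 1 / 4 ^ n))"
  have S[measurable]: "S n \<in> sets borel" for n by (auto simp: S_def unit_disc_def)
  have "(\<integral>\<^sup>+z. indicator unit_disc z * ennreal (1 / sqrt (1 - cmod z) / pi) \<partial>lborel)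
      \<le> (\<integral>\<^sup>+z. (\<Sum>n. ennreal (2 ^ (n + 1) / pi) * indicator (S n) z) \<partial>lborel)"
  proof (rule nn_integral_mono)
    fix z :: complex
    show "indicator unit_disc z * ennreal (1 / sqrt (1 - cmod z) / pi)
      \<le> (\<Sum>n. ennreal (2 ^ (n + 1) / pi) * indicator (S n) z)"
    proof (cases "z \<in> unit_disc")
      case True
      then have z: "cmod z < 1" by (simp add: unit_disc_def)
      obtain n where n: "(1/4) ^ n < 1 - cmod z"
        using z real_arch_pow_inv[of "1 - cmod z" "1/4"] by auto
      have ex: "\<exists>n. (1/4) ^ (n + 1) \<le> 1 - cmod z"
        using n zero_less_power[of "1/4::real" n] by (intro exI[of _ n]) (simp only: power_add power_one_right; linarith)
      \<comment> \<open>Minimality places \<open>1 - cmod z\<close> between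
        \<open>(1/4) ^ (n + 1)\<close> and \<open>(1/4) ^ n\<close>. The annuli are nested, but the
        single term with this \<open>n\<close> already dominates the weight at
        \<open>z\<close>.\<close>
      define n where "n = (LEAST n. (1/4) ^ (n + 1) \<le> 1 - cmod z)"
      have n: "(1/4) ^ (n + 1) \<le> 1 - cmod z" unfolding n_def by (rule LeastI_ex[OF ex])
      have "1 - cmod z \<le> (1/4) ^ n"
      proof (cases n)
        case (Suc m)
        then have "\<not> (1/4) ^ (m + 1) \<le> 1 - cmod z"
          using not_less_Least[of m "\<lambda>n. (1/4) ^ (n + 1) \<le> 1 - cmod z"] by (simp add: n_def)
        then show ?thesis using Suc by simp
      qed auto
      then have zS: "z \<in> S n" using True by (simp add: S_def power_one_over)
      have "1 / 2 ^ (n + 1) = sqrt ((1/4) ^ (n + 1))"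
        by (simp only: power_one_over four real_sqrt_divide real_sqrt_one real_sqrt_abs power_abs abs_numeral)
      also have "\<dots> \<le> sqrt (1 - cmod z)" using n by simp
      finally have "1 / sqrt (1 - cmod z) \<le> 2 ^ (n + 1)"
        using z by (simp add: field_simps)
      then have "ennreal (1 / sqrt (1 - cmod z) / pi) \<le> ennreal (2 ^ (n + 1) / pi)"
        by (intro ennreal_leI divide_right_mono) auto
      also have "\<dots> = (\<Sum>k\<in>{n}. ennreal (2 ^ (k + 1) / pi) * indicator (S k) z)" using zS by simp
      also have "\<dots> \<le> (\<Sum>k. ennreal (2 ^ (k + 1) / pi) * indicator (S k) z)"
        by (intro sum_le_suminf) auto
      finally show ?thesis using True by simp
    qed auto
  qed
  also have "\<dots> = (\<Sum>n. ennreal (2 ^ (n + 1) / pi) * emeasure lborel (S n))"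
    by (simp add: nn_integral_suminf nn_integral_cmult_indicator)
  also have "\<dots> \<le> (\<Sum>n. ennreal (4 * (1/2) ^ n))"
  proof (intro suminf_le)
    fix n :: nat
    define r :: real where "r = 1 - 1 / 4 ^ n"
    have r: "0 \<le> r" "r \<le> 1" by (auto simp: r_def)
    have "1 - r\<^sup>2 \<le> 2 * (1 - r)" using zero_le_power2[of "1 - r"] by (simp add: power2_eq_square algebra_simps)
    then have "1 - r\<^sup>2 \<le> 2 / 4 ^ n" by (simp add: r_def)
    then have "2 ^ (n + 1) * (1 - r\<^sup>2) \<le> 2 ^ (n + 1) * (2 / 4 ^ n)" by (intro mult_left_mono) auto
    also have "\<dots> = 4 * (1/2) ^ n"
      unfolding four by (simp add: power_one_over power2_eq_square)
    finally have *: "2 ^ (n + 1) * (1 - r\<^sup>2) \<le> 4 * (1/2) ^ n" .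
    have "ennreal (2 ^ (n + 1) / pi) * emeasure lborel (S n) = ennreal (2 ^ (n + 1) * (1 - r\<^sup>2))"
      unfolding S_def r_def[symmetric] emeasure_unit_disc_Diff_ball[OF r]
      by (subst ennreal_mult'[symmetric]) (auto simp: mult_ac)
    also have "\<dots> \<le> ennreal (4 * (1/2) ^ n)" using * by (rule ennreal_leI)
    finally show "ennreal (2 ^ (n + 1) / pi) * emeasure lborel (S n) \<le> ennreal (4 * (1/2) ^ n)" .
  qed auto
  also have "\<dots> = ennreal (\<Sum>n. 4 * (1/2) ^ n)"
    by (intro suminf_ennreal2) auto
  also have "\<dots> = 8" by (simp add: suminf_mult suminf_geometric)
  finally show ?thesis .
qed

text \<open>The square of the weight is \<open>1 / sqrt (1 - cmod z)\<close>, whose normalized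
  integral is at most 8, and 8 is below the square of 3. Keeping \<open>c\<close> as a factor admits
  \<open>c = 0\<close>, which occurs at zeros of \<open>u\<close>.\<close>

lemma A2_norm_le_of_growth:
  assumes "0 \<le> c" "0 \<le> K"
    and h: "\<And>z. z \<in> unit_disc \<Longrightarrow> c * cmod (h z) \<le> K * (1 - cmod z) powr (-1/4)"
  shows "ennreal c * A2_norm h \<le> ennreal (3 * K)"
proof (cases "c = 0")
  case False
  then have c: "c > 0" using assms by simp
  have [measurable]: "unit_disc \<in> sets borel" by (simp add: unit_disc_def)
  have [measurable]: "(\<lambda>z. 1 / sqrt (1 - cmod z) / pi) \<in> borel_measurable borel"
    by (intro borel_measurable_divide borel_measurable_continuous_onI continuous_intros)
  have "(\<integral>\<^sup>+z. indicator unit_disc z * ennreal ((cmod (h z))\<^sup>2 / pi) \<partial>lborel)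
     \<le> (\<integral>\<^sup>+z. ennreal ((K / c)\<^sup>2) * (indicator unit_disc z * ennreal (1 / sqrt (1 - cmod z) / pi)) \<partial>lborel)"
  proof (rule nn_integral_mono)
    fix z :: complex
    show "indicator unit_disc z * ennreal ((cmod (h z))\<^sup>2 / pi)
      \<le> ennreal ((K / c)\<^sup>2) * (indicator unit_disc z * ennreal (1 / sqrt (1 - cmod z) / pi))"
    proof (cases "z \<in> unit_disc")
      case True
      then have z: "1 - cmod z > 0" by (simp add: unit_disc_def)
      have "cmod (h z) \<le> (K / c) * (1 - cmod z) powr (-1/4)"
        using h[OF True] c by (simp add: field_simps)
      then have "(cmod (h z))\<^sup>2 \<le> ((K / c) * (1 - cmod z) powr (-1/4))\<^sup>2"
        by (rule power_mono) auto
      also have "\<dots> = (K / c)\<^sup>2 * (1 / sqrt (1 - cmod z))"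
      proof -
        have "((1 - cmod z) powr (-1/4))\<^sup>2 = (1 - cmod z) powr (- (1/2))"
          by (simp add: power2_eq_square flip: powr_add)
        also have "\<dots> = 1 / sqrt (1 - cmod z)"
          using z by (simp only: powr_minus_divide) (simp add: powr_half_sqrt)
        finally show ?thesis by (simp only: power_mult_distrib)
      qed
      finally have "(cmod (h z))\<^sup>2 / pi \<le> (K / c)\<^sup>2 * (1 / sqrt (1 - cmod z)) / pi"
        by (rule divide_right_mono) simp
      then have "(cmod (h z))\<^sup>2 / pi \<le> (K / c)\<^sup>2 * (1 / sqrt (1 - cmod z) / pi)"
        by simp
      then show ?thesis
        using True z by (simp add: ennreal_mult'[symmetric] ennreal_leI)
    qed auto
  qed
  also have "\<dots> = ennreal ((K / c)\<^sup>2) * (\<integral>\<^sup>+z. indicator unit_disc z * ennreal (1 / sqrt (1 - cmod z) / pi) \<partial>lborel)"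
    by (rule nn_integral_cmult) measurable
  also have "\<dots> \<le> ennreal ((K / c)\<^sup>2) * 8"
    by (intro mult_left_mono nn_integral_inverse_sqrt_unit_disc) auto
  also have "\<dots> = ennreal ((K / c)\<^sup>2 * 8)" by (simp add: ennreal_mult)
  also have "\<dots> \<le> ennreal ((3 * K / c)\<^sup>2)"
    by (intro ennreal_leI) (simp add: power_divide power_mult_distrib divide_right_mono)
  finally have "A2_norm h \<le> ennreal (3 * K / c)"
    using c assms(2) by (intro A2_norm_le) auto
  then have "ennreal c * A2_norm h \<le> ennreal c * ennreal (3 * K / c)" by (rule mult_left_mono) auto
  also have "\<dots> = ennreal (3 * K)" using c assms(2) by (subst ennreal_mult'[symmetric]) auto
  finally show ?thesis .
qed auto

text \<open>The mean value inequality along the radius through \<open>z\<close>, run at unit speed,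
  with \<open>P'\<close> as a radial majorant of the derivative.\<close>

lemma norm_diff_le_radial:
  assumes v: "v holomorphic_on unit_disc"
    and P: "\<And>r. 0 \<le> r \<Longrightarrow> r < 1 \<Longrightarrow> (P has_real_derivative P' r) (at r)"
    and le: "\<And>z. z \<in> unit_disc \<Longrightarrow> cmod (deriv v z) \<le> P' (cmod z)"
    and z: "z \<in> unit_disc"
  shows "cmod (v z - v 0) \<le> P (cmod z) - P 0"
proof (cases "z = 0")
  case False
  define e where "e = z / of_real (cmod z)"
  have e: "cmod e = 1" using False by (simp add: e_def norm_divide)
  have z1: "cmod z < 1" using z by (simp add: unit_disc_def)
  have D: "of_real t * e \<in> unit_disc" if "0 \<le> t" "t < 1" for t :: real
    using that e by (simp add: unit_disc_def norm_mult)
  have dv: "((\<lambda>t. v (of_real t * e)) has_vector_derivative (e * deriv v (of_real t * e))) (at t)"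
    if "0 \<le> t" "t < 1" for t
  proof -
    have "(v has_field_derivative deriv v (of_real t * e)) (at (of_real t * e))"
      using v D[OF that] by (intro holomorphic_derivI) (auto simp: unit_disc_def)
    moreover have "((\<lambda>t. of_real t * e) has_vector_derivative e) (at t)"
      by (auto intro!: derivative_eq_intros)
    ultimately show ?thesis
      using field_vector_diff_chain_at[of "\<lambda>t. of_real t * e" e t v] by (simp add: o_def)
  qed
  have "norm (v (of_real (cmod z) * e) - v (of_real 0 * e)) \<le> P (cmod z) - P 0"
  proof (rule differentiable_bound_general[of 0 "cmod z" "\<lambda>t. v (of_real t * e)" P
        "\<lambda>t. e * deriv v (of_real t * e)" P'])
    show "continuous_on {0..cmod z} (\<lambda>t. v (of_real t * e))"
      using z1 by (intro continuous_at_imp_continuous_on ballI has_vector_derivative_continuous[OF dv]) auto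
    show "continuous_on {0..cmod z} P"
      using z1 by (intro continuous_at_imp_continuous_on ballI DERIV_isCont[OF P]) auto
    show "norm (e * deriv v (of_real t * e)) \<le> P' t" if "0 < t" "t < cmod z" for t
      using le[OF D[of t]] that z1 e by (simp add: norm_mult)
  qed (use False z1 dv P in \<open>auto simp: has_real_derivative_iff_has_vector_derivative\<close>)
  then show ?thesis using False by (simp add: e_def)
qed simp

text \<open>Passing to the derivative costs one power of \<open>1 - cmod z\<close>, and integration
  along the radius regains it: \<open>4 * K * (1 - r) powr (-1/4)\<close> is an antiderivative of
  \<open>K * (1 - r) powr (-5/4)\<close>.\<close>

lemma norm_diff_le_powr:
  assumes v: "v holomorphic_on unit_disc"
    and le: "\<And>z. z \<in> unit_disc \<Longrightarrow> (1 - (cmod z)\<^sup>2) * cmod (deriv v z) \<le> K * (1 - cmod z) powr (-1/4)"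
    and K: "K \<ge> 0" and z: "z \<in> unit_disc"
  shows "cmod (v z - v 0) \<le> 4 * K * (1 - cmod z) powr (-1/4)"
proof -
  have "cmod (v z - v 0) \<le> 4 * K * (1 - cmod z) powr (-1/4) - 4 * K * (1 - 0) powr (-1/4)"
  proof (rule norm_diff_le_radial[OF v _ _ z, where P' = "\<lambda>r. K * (1 - r) powr (-5/4)"])
    show "((\<lambda>r. 4 * K * (1 - r) powr (-1/4)) has_real_derivative K * (1 - r) powr (-5/4)) (at r)"
      if "0 \<le> r" "r < 1" for r
      using that by (auto intro!: derivative_eq_intros)
    fix w assume w: "w \<in> unit_disc"
    then have w1: "1 - cmod w > 0" by (simp add: unit_disc_def)
    have "(1 - cmod w) * cmod (deriv v w) \<le> (1 - (cmod w)\<^sup>2) * cmod (deriv v w)"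
      using w1 by (intro mult_right_mono) (auto simp: power2_eq_square mult_left_le)
    also have "\<dots> \<le> K * (1 - cmod w) powr (-1/4)" by (rule le[OF w])
    finally have "cmod (deriv v w) \<le> K * ((1 - cmod w) powr (-1/4) / (1 - cmod w))"
      using w1 by (simp add: field_simps)
    also have "(1 - cmod w) powr (-1/4) / (1 - cmod w) = (1 - cmod w) powr (-1/4 - 1)"
      using w1 by (simp only: powr_diff) simp
    finally show "cmod (deriv v w) \<le> K * (1 - cmod w) powr (-5/4)" by simp
  qed
  also have "\<dots> \<le> 4 * K * (1 - cmod z) powr (-1/4)" using K by simp
  finally show ?thesis .
qed

section \<open>Disc automorphisms\<close>

text \<open>The order of growth of Bloch functions; the 2 in the numerator keeps it bounded away
  from 0 at the origin.\<close>

abbreviation (input) log_weight :: "complex \<Rightarrow> real" where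
  "log_weight z \<equiv> ln (2 / (1 - (cmod z)\<^sup>2))"

lemma norm_less_1_of_unit_disc: "z \<in> unit_disc \<Longrightarrow> cmod z < 1"
  by (simp add: unit_disc_def)

lemma one_minus_norm_sq_pos: "z \<in> unit_disc \<Longrightarrow> 0 < 1 - (cmod z)\<^sup>2"
  by (simp add: unit_disc_def abs_square_less_1)

lemma open_unit_disc [simp]: "open unit_disc"
  by (simp add: unit_disc_def)

lemma zero_in_unit_disc [simp]: "0 \<in> unit_disc"
  by (simp add: unit_disc_def)

text \<open>Allows additive constants to be absorbed into multiples of
  \<open>log_weight\<close>.\<close>

lemma log_weight_ge: "z \<in> unit_disc \<Longrightarrow> 2 / 3 \<le> log_weight z"
  by (rule order.trans[OF ln2_ge_two_thirds], rule ln_mono)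
    (use one_minus_norm_sq_pos[of z] in \<open>auto simp: field_simps\<close>)

lemma disc_aut_denom_ne_0:
  assumes "a \<in> unit_disc" "z \<in> unit_disc"
  shows "1 - cnj a * z \<noteq> 0"
proof
  assume "1 - cnj a * z = 0"
  then have "cmod a * cmod z = 1" by (metis complex_mod_cnj eq_iff_diff_eq_0 norm_mult norm_one)
  moreover have "cmod a * cmod z \<le> cmod a * 1"
    using norm_less_1_of_unit_disc[OF assms(2)] by (intro mult_left_mono) auto
  ultimately show False using norm_less_1_of_unit_disc[OF assms(1)] by linarith
qed

lemma one_minus_norm_disc_aut:
  assumes "a \<in> unit_disc" "z \<in> unit_disc"
  shows "1 - (cmod (disc_aut a z))\<^sup>2 = (1 - (cmod a)\<^sup>2) * (1 - (cmod z)\<^sup>2) / (cmod (1 - cnj a * z))\<^sup>2"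
proof -
  have "(cmod (1 - cnj a * z))\<^sup>2 - (cmod (a - z))\<^sup>2 = (1 - (cmod a)\<^sup>2) * (1 - (cmod z)\<^sup>2)"
    by (simp add: cmod_power2) (simp add: power2_eq_square algebra_simps)
  then show ?thesis
    using disc_aut_denom_ne_0[OF assms] by (simp add: disc_aut_def norm_divide power_divide diff_divide_eq_iff field_simps)
qed

lemma disc_aut_in_unit_disc:
  assumes "a \<in> unit_disc" "z \<in> unit_disc"
  shows "disc_aut a z \<in> unit_disc"
proof -
  have "0 < 1 - (cmod (disc_aut a z))\<^sup>2"
    unfolding one_minus_norm_disc_aut[OF assms]
    using assms disc_aut_denom_ne_0[OF assms] by (intro divide_pos_pos mult_pos_pos one_minus_norm_sq_pos) auto
  then show ?thesis by (simp add: unit_disc_def abs_square_less_1)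
qed

lemma disc_aut_0 [simp]: "disc_aut a 0 = a"
  by (simp add: disc_aut_def)

lemma disc_aut_self [simp]: "disc_aut a a = 0"
  by (simp add: disc_aut_def)

lemma disc_aut_disc_aut:
  assumes "a \<in> unit_disc" "z \<in> unit_disc"
  shows "disc_aut a (disc_aut a z) = z"
proof -
  note ne = disc_aut_denom_ne_0[OF assms] disc_aut_denom_ne_0[OF assms(1) assms(1)]
    disc_aut_denom_ne_0[OF assms(1) disc_aut_in_unit_disc[OF assms]]
  have n: "a - disc_aut a z = z * (1 - cnj a * a) / (1 - cnj a * z)"
    using ne(1) by (simp add: disc_aut_def field_simps)
  have d: "1 - cnj a * disc_aut a z = (1 - cnj a * a) / (1 - cnj a * z)"
    using ne(1) by (simp add: disc_aut_def field_simps)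
  show ?thesis
    unfolding disc_aut_def[of a "disc_aut a z"] n d using ne by simp
qed

lemma has_field_derivative_disc_aut:
  assumes "a \<in> unit_disc" "z \<in> unit_disc"
  shows "(disc_aut a has_field_derivative - (1 - cnj a * a) / (1 - cnj a * z)\<^sup>2) (at z)"
  unfolding disc_aut_def using disc_aut_denom_ne_0[OF assms]
  by (auto intro!: derivative_eq_intros simp: power2_eq_square field_simps)

lemma disc_aut_holomorphic: "a \<in> unit_disc \<Longrightarrow> disc_aut a holomorphic_on unit_disc"
  using has_field_derivative_disc_aut by (auto simp: holomorphic_on_open)

text \<open>Automorphisms attain equality in the Schwarz-Pick inequality.\<close>

lemma norm_deriv_disc_aut:
  assumes "a \<in> unit_disc" "z \<in> unit_disc"
  shows "(1 - (cmod z)\<^sup>2) * cmod (deriv (disc_aut a) z) = 1 - (cmod (disc_aut a z))\<^sup>2"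
proof -
  have "1 - cnj a * a = of_real (1 - (cmod a)\<^sup>2)"
    using complex_norm_square[of a] by (simp add: mult.commute)
  then have "cmod (1 - cnj a * a) = 1 - (cmod a)\<^sup>2"
    using one_minus_norm_sq_pos[OF assms(1)] by (simp only: norm_of_real abs_of_pos)
  then show ?thesis
    unfolding one_minus_norm_disc_aut[OF assms] DERIV_imp_deriv[OF has_field_derivative_disc_aut[OF assms]]
    by (simp add: norm_divide norm_power norm_minus_commute)
qed

section \<open>Chain rule and conformal invariance of the weighted derivative\<close>

lemma deriv_comp_unit_disc:
  assumes "f holomorphic_on unit_disc" "g holomorphic_on unit_disc" "g z \<in> unit_disc" "z \<in> unit_disc"
  shows "deriv (\<lambda>z. f (g z)) z = deriv f (g z) * deriv g z"
  using deriv_chain[of g z f] assms holomorphic_on_imp_differentiable_at[OF _ open_unit_disc]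
  by (simp add: o_def)

lemma holomorphic_on_comp_unit_disc:
  assumes "f holomorphic_on unit_disc" "g holomorphic_on unit_disc" "\<And>z. z \<in> unit_disc \<Longrightarrow> g z \<in> unit_disc"
  shows "(\<lambda>z. f (g z)) holomorphic_on unit_disc"
  using holomorphic_on_compose_gen[of g unit_disc f unit_disc] assms by (auto simp: o_def)

text \<open>Pointwise Bloch bounds are conformally invariant, so estimates at \<open>a\<close> can
  be moved to the origin.\<close>

lemma norm_deriv_comp_disc_aut:
  assumes "f holomorphic_on unit_disc" "a \<in> unit_disc" "z \<in> unit_disc"
  shows "(1 - (cmod z)\<^sup>2) * cmod (deriv (\<lambda>z. f (disc_aut a z)) z)
    = (1 - (cmod (disc_aut a z))\<^sup>2) * cmod (deriv f (disc_aut a z))"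
  using norm_deriv_disc_aut[OF assms(2,3)]
  by (simp add: deriv_comp_unit_disc[OF assms(1) disc_aut_holomorphic[OF assms(2)] disc_aut_in_unit_disc]
      assms norm_mult mult_ac)

section \<open>The upper bound\<close>

text \<open>Replaces the extended-valued supremum by real inequalities. The constant term can stay
  inside the quantifier because the disc is nonempty.\<close>

lemma bloch_norm_le_iff:
  assumes "B \<ge> 0"
  shows "bloch_norm f \<le> ennreal B \<longleftrightarrow>
    (\<forall>z\<in>unit_disc. cmod (f 0) + (1 - (cmod z)\<^sup>2) * cmod (deriv f z) \<le> B)"
proof
  assume B: "bloch_norm f \<le> ennreal B"
  show "\<forall>z\<in>unit_disc. cmod (f 0) + (1 - (cmod z)\<^sup>2) * cmod (deriv f z) \<le> B"
  proof
    fix z assume z: "z \<in> unit_disc"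
    have "ennreal (cmod (f 0) + (1 - (cmod z)\<^sup>2) * cmod (deriv f z))
      = ennreal (cmod (f 0)) + ennreal ((1 - (cmod z)\<^sup>2) * cmod (deriv f z))"
      using one_minus_norm_sq_pos[OF z] by (intro ennreal_plus) auto
    also have "\<dots> \<le> bloch_norm f"
      unfolding bloch_norm_def bloch_seminorm_def using z by (intro add_left_mono SUP_upper)
    finally have "ennreal (cmod (f 0) + (1 - (cmod z)\<^sup>2) * cmod (deriv f z)) \<le> ennreal B"
      using B by order
    then show "cmod (f 0) + (1 - (cmod z)\<^sup>2) * cmod (deriv f z) \<le> B"
      using assms by (simp add: ennreal_le_iff)
  qed
next
  assume *: "\<forall>z\<in>unit_disc. cmod (f 0) + (1 - (cmod z)\<^sup>2) * cmod (deriv f z) \<le> B"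
  \<comment> \<open>The instance at 0 ensures that \<open>B - cmod (f 0)\<close> is nonnegative, so
    \<open>ennreal\<close> does not truncate it.\<close>
  then have "cmod (f 0) + (1 - (cmod 0)\<^sup>2) * cmod (deriv f 0) \<le> B" by (rule bspec) simp
  then have f0: "cmod (f 0) \<le> B" by (smt (verit) norm_ge_zero mult_nonneg_nonneg norm_zero power_zero_numeral)
  have "bloch_norm f \<le> ennreal (cmod (f 0)) + ennreal (B - cmod (f 0))"
    unfolding bloch_norm_def bloch_seminorm_def
    using * by (intro add_left_mono SUP_least ennreal_leI) (auto simp: algebra_simps)
  also have "\<dots> = ennreal B" using f0 by (simp flip: ennreal_plus)
  finally show "bloch_norm f \<le> ennreal B" .
qed

text \<open>Radial integration of \<open>1 / (1 - r)\<close> gives a logarithm, and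
  \<open>1 - (cmod w)\<^sup>2 \<le> 2 * (1 - cmod w)\<close> compares it with
  \<open>log_weight w\<close>.\<close>

lemma norm_le_log_weight_of_bloch_norm:
  assumes f: "f holomorphic_on unit_disc" and B: "bloch_norm f \<le> 1" and w: "w \<in> unit_disc"
  shows "cmod (f w) \<le> 3 * log_weight w"
proof -
  have b: "cmod (f 0) + (1 - (cmod z)\<^sup>2) * cmod (deriv f z) \<le> 1" if "z \<in> unit_disc" for z
    using B bloch_norm_le_iff[of 1 f] that by simp
  have "cmod (f w - f 0) \<le> - ln (1 - cmod w) - (- ln (1 - 0))"
  proof (rule norm_diff_le_radial[OF f _ _ w, where P' = "\<lambda>r. 1 / (1 - r)"])
    show "((\<lambda>r. - ln (1 - r)) has_real_derivative 1 / (1 - r)) (at r)" if "0 \<le> r" "r < 1" for r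
      using that by (auto intro!: derivative_eq_intros)
    fix z assume z: "z \<in> unit_disc"
    then have z1: "1 - cmod z > 0" by (simp add: unit_disc_def)
    have "(1 - cmod z) * cmod (deriv f z) \<le> (1 - (cmod z)\<^sup>2) * cmod (deriv f z)"
      using z1 by (intro mult_right_mono) (auto simp: power2_eq_square mult_left_le)
    also have "\<dots> \<le> 1" using b[OF z] norm_ge_zero[of "f 0"] by linarith
    finally show "cmod (deriv f z) \<le> 1 / (1 - cmod z)" using z1 by (simp add: field_simps)
  qed
  also have "\<dots> = ln (1 / (1 - cmod w))"
    using norm_less_1_of_unit_disc[OF w] by (simp add: ln_div)
  also have "\<dots> \<le> log_weight w"
  proof (rule ln_mono)
    have "1 - (cmod w)\<^sup>2 \<le> 2 * (1 - cmod w)"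
      using zero_le_power2[of "1 - cmod w"] by (simp add: power2_diff)
    moreover have "1 / x \<le> 2 / y" if "y \<le> 2 * x" "0 < x" "0 < y" for x y :: real
      using that by (simp add: field_simps)
    ultimately show "1 / (1 - cmod w) \<le> 2 / (1 - (cmod w)\<^sup>2)"
      using norm_less_1_of_unit_disc[OF w] one_minus_norm_sq_pos[OF w] by simp
  qed (use norm_less_1_of_unit_disc[OF w] one_minus_norm_sq_pos[OF w] in auto)
  finally have "cmod (f w - f 0) \<le> log_weight w" .
  moreover have "cmod (f 0) \<le> 1" using b[of 0] by (smt (verit) norm_ge_zero mult_nonneg_nonneg norm_zero power_zero_numeral zero_in_unit_disc)
  moreover have "cmod (f w) \<le> cmod (f w - f 0) + cmod (f 0)" by (metis diff_add_cancel norm_triangle_ineq)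
  \<comment> \<open>The value at 0 is at most 1, hence at most 3/2 times the weight; the total 5/2
    is below 3.\<close>
  ultimately show ?thesis using log_weight_ge[OF w] by linarith
qed

text \<open>Subtracting \<open>u a\<close> makes the recentred function vanish at 0, where its
  derivative has modulus \<open>(1 - (cmod a)\<^sup>2) * cmod (deriv u a)\<close>.\<close>

lemma deriv_weight_le_beta_fn:
  assumes u: "u holomorphic_on unit_disc" and \<phi>: "self_map \<phi>" and a: "a \<in> unit_disc"
  shows "ennreal (log_weight (\<phi> a) * ((1 - (cmod a)\<^sup>2) * cmod (deriv u a))) \<le> 23 * beta_fn u \<phi> a"
proof -
  have \<phi>a: "\<phi> a \<in> unit_disc" using \<phi> a by (auto simp: self_map_def)
  have hol: "(\<lambda>z. u (disc_aut a z)) holomorphic_on unit_disc"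
    using a by (intro holomorphic_on_comp_unit_disc[OF u] disc_aut_holomorphic disc_aut_in_unit_disc)
  have "deriv (\<lambda>z. u (disc_aut a z) - u a) 0 = deriv (\<lambda>z. u (disc_aut a z)) 0"
    using holomorphic_on_imp_differentiable_at[OF hol] by simp
  then have "cmod (deriv (\<lambda>z. u (disc_aut a z) - u a) 0) = (1 - (cmod a)\<^sup>2) * cmod (deriv u a)"
    using norm_deriv_comp_disc_aut[OF u a, of 0] by simp
  moreover have "ennreal (cmod (deriv (\<lambda>z. u (disc_aut a z) - u a) 0)) \<le> 23 * A2_norm (\<lambda>z. u (disc_aut a z) - u a)"
    by (rule norm_deriv_0_le_A2_norm) (auto intro!: holomorphic_intros hol)
  ultimately have "ennreal (log_weight (\<phi> a)) * ennreal ((1 - (cmod a)\<^sup>2) * cmod (deriv u a))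
      \<le> ennreal (log_weight (\<phi> a)) * (23 * A2_norm (\<lambda>z. u (disc_aut a z) - u a))"
    by (intro mult_left_mono) auto
  then show ?thesis
    unfolding beta_fn_def using log_weight_ge[OF \<phi>a]
    by (subst ennreal_mult') (linarith, simp only: mult.left_commute)
qed

text \<open>Recentring both source and target gives a self-map fixing 0; the modulus of its
  derivative there is the hyperbolic derivative of \<phi> at \<open>a\<close>.\<close>

lemma deriv_symbol_le_alpha_fn:
  assumes \<phi>: "self_map \<phi>" and a: "a \<in> unit_disc"
  shows "ennreal (cmod (u a) * ((1 - (cmod a)\<^sup>2) * cmod (deriv \<phi> a) / (1 - (cmod (\<phi> a))\<^sup>2)))
    \<le> 23 * alpha_fn u \<phi> a"
proof -
  have \<phi>h: "\<phi> holomorphic_on unit_disc" and \<phi>D: "\<And>z. z \<in> unit_disc \<Longrightarrow> \<phi> z \<in> unit_disc"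
    using \<phi> by (auto simp: self_map_def)
  define \<psi> where "\<psi> = disc_aut (\<phi> a) \<circ> \<phi> \<circ> disc_aut a"
  note b = \<phi>D[OF a]
  have h1: "(\<lambda>z. \<phi> (disc_aut a z)) holomorphic_on unit_disc"
    using a by (intro holomorphic_on_comp_unit_disc[OF \<phi>h] disc_aut_holomorphic disc_aut_in_unit_disc)
  have h2: "\<psi> holomorphic_on unit_disc"
    unfolding \<psi>_def o_def using a
    by (intro holomorphic_on_comp_unit_disc[OF disc_aut_holomorphic h1] b \<phi>D disc_aut_in_unit_disc)
  have "deriv \<psi> 0 = deriv (disc_aut (\<phi> a)) (\<phi> a) * deriv (\<lambda>z. \<phi> (disc_aut a z)) 0"
    unfolding \<psi>_def o_def
    using deriv_comp_unit_disc[OF disc_aut_holomorphic[OF b] h1, of 0] b by simp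
  moreover have "cmod (deriv (disc_aut (\<phi> a)) (\<phi> a)) = 1 / (1 - (cmod (\<phi> a))\<^sup>2)"
    using norm_deriv_disc_aut[OF b b] one_minus_norm_sq_pos[OF b] by (simp add: field_simps)
  ultimately have eq: "cmod (deriv \<psi> 0) = (1 - (cmod a)\<^sup>2) * cmod (deriv \<phi> a) / (1 - (cmod (\<phi> a))\<^sup>2)"
    using norm_deriv_comp_disc_aut[OF \<phi>h a, of 0] by (simp add: norm_mult)
  have "ennreal (cmod (deriv \<psi> 0)) \<le> 23 * A2_norm \<psi>"
    by (rule norm_deriv_0_le_A2_norm[OF h2]) (simp add: \<psi>_def)
  then have "ennreal (cmod (u a)) * ennreal (cmod (deriv \<psi> 0)) \<le> ennreal (cmod (u a)) * (23 * A2_norm \<psi>)"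
    by (intro mult_left_mono) auto
  then show ?thesis
    unfolding eq alpha_fn_def \<psi>_def[symmetric]
    by (subst ennreal_mult') (simp_all only: norm_ge_zero mult.left_commute)
qed

lemma deriv_weighted_comp:
  assumes "u holomorphic_on unit_disc" "self_map \<phi>" "f holomorphic_on unit_disc" "z \<in> unit_disc"
  shows "deriv (\<lambda>z. u z * f (\<phi> z)) z = deriv u z * f (\<phi> z) + u z * (deriv f (\<phi> z) * deriv \<phi> z)"
proof -
  have \<phi>: "\<phi> holomorphic_on unit_disc" "\<And>z. z \<in> unit_disc \<Longrightarrow> \<phi> z \<in> unit_disc"
    using assms(2) by (auto simp: self_map_def)
  have "(u has_field_derivative deriv u z) (at z)"
    using assms by (intro holomorphic_derivI) auto
  moreover have "((\<lambda>z. f (\<phi> z)) has_field_derivative deriv (\<lambda>z. f (\<phi> z)) z) (at z)"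
    using holomorphic_on_comp_unit_disc[OF assms(3) \<phi>] assms(4) by (intro holomorphic_derivI) auto
  ultimately have "((\<lambda>z. u z * f (\<phi> z)) has_field_derivative
      deriv u z * f (\<phi> z) + deriv (\<lambda>z. f (\<phi> z)) z * u z) (at z)"
    by (rule DERIV_mult)
  then show ?thesis
    using deriv_comp_unit_disc[OF assms(3) \<phi>(1)] \<phi>(2) assms(4)
    by (simp add: DERIV_imp_deriv mult_ac)
qed

lemma wco_norm_upper_bound:
  assumes u: "u holomorphic_on unit_disc" and \<phi>: "self_map \<phi>"
  shows "wco_norm u \<phi> \<le> 69 * (ennreal (cmod (u 0) * log_weight (\<phi> 0))
    + (SUP a\<in>unit_disc. alpha_fn u \<phi> a) + (SUP a\<in>unit_disc. beta_fn u \<phi> a))"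
  unfolding wco_norm_def
proof (rule SUP_least, clarify)
  fix f assume f: "f holomorphic_on unit_disc" and B: "bloch_norm f \<le> 1"
  define \<alpha> where "\<alpha> = (SUP a\<in>unit_disc. alpha_fn u \<phi> a)"
  define \<beta> where "\<beta> = (SUP a\<in>unit_disc. beta_fn u \<phi> a)"
  have \<phi>D: "\<phi> z \<in> unit_disc" if "z \<in> unit_disc" for z
    using \<phi> that by (auto simp: self_map_def)
  note fl = norm_le_log_weight_of_bloch_norm[OF f B]
  have fb: "(1 - (cmod w)\<^sup>2) * cmod (deriv f w) \<le> 1" if "w \<in> unit_disc" for w
    using B bloch_norm_le_iff[of 1 f] that by (smt (verit) norm_ge_zero ennreal_1)
  have "ennreal ((1 - (cmod z)\<^sup>2) * cmod (deriv (\<lambda>z. u z * f (\<phi> z)) z)) \<le> 69 * \<beta> + 69 * \<alpha>"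
    if z: "z \<in> unit_disc" for z
  proof -
    let ?z = "1 - (cmod z)\<^sup>2" and ?p = "1 - (cmod (\<phi> z))\<^sup>2"
    have p: "?p > 0" "?z > 0" by (simp_all only: one_minus_norm_sq_pos z \<phi>D)
    have L: "log_weight (\<phi> z) \<ge> 0" using log_weight_ge[OF \<phi>D[OF z]] by linarith
    have "?z * cmod (deriv (\<lambda>z. u z * f (\<phi> z)) z)
      \<le> ?z * (cmod (deriv u z) * cmod (f (\<phi> z)) + cmod (u z) * (cmod (deriv f (\<phi> z)) * cmod (deriv \<phi> z)))"
      unfolding deriv_weighted_comp[OF u \<phi> f z] using p
      by (intro mult_left_mono order.trans[OF norm_triangle_ineq]) (auto simp: norm_mult)
    also have "\<dots> = ?z * cmod (deriv u z) * cmod (f (\<phi> z))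
        + cmod (u z) * (?z * cmod (deriv \<phi> z)) * cmod (deriv f (\<phi> z))"
      by (simp add: algebra_simps)
    also have "\<dots> \<le> ?z * cmod (deriv u z) * (3 * log_weight (\<phi> z))
        + cmod (u z) * (?z * cmod (deriv \<phi> z)) * (1 / ?p)"
    proof -
      have "cmod (deriv f (\<phi> z)) \<le> 1 / ?p" using fb[OF \<phi>D[OF z]] p by (simp add: field_simps)
      with p fl[OF \<phi>D[OF z]] show ?thesis
        by (intro add_mono mult_left_mono mult_nonneg_nonneg) simp_all
    qed
    finally have "ennreal (?z * cmod (deriv (\<lambda>z. u z * f (\<phi> z)) z))
      \<le> ennreal (3 * (log_weight (\<phi> z) * (?z * cmod (deriv u z))) + cmod (u z) * (?z * cmod (deriv \<phi> z) / ?p))"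
      by (intro ennreal_leI) (simp add: mult_ac)
    also have "\<dots> = 3 * ennreal (log_weight (\<phi> z) * (?z * cmod (deriv u z)))
        + ennreal (cmod (u z) * (?z * cmod (deriv \<phi> z) / ?p))"
      using p L by (subst ennreal_plus) (auto simp: ennreal_mult)
    also have "\<dots> \<le> 3 * (23 * beta_fn u \<phi> z) + 23 * alpha_fn u \<phi> z"
      by (intro add_mono mult_left_mono deriv_weight_le_beta_fn deriv_symbol_le_alpha_fn u \<phi> z) auto
    \<comment> \<open>The coefficient 23 is raised to 69 = 3 * 23 to obtain a common factor for all
      terms.\<close>
    also have "\<dots> \<le> 3 * (23 * \<beta>) + 69 * \<alpha>"
      unfolding \<alpha>_def \<beta>_def using z by (intro add_mono mult_mono mult_left_mono SUP_upper) auto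
    finally show ?thesis by (simp add: mult.assoc[symmetric])
  qed
  then have "bloch_seminorm (\<lambda>z. u z * f (\<phi> z)) \<le> 69 * \<beta> + 69 * \<alpha>"
    unfolding bloch_seminorm_def by (rule SUP_least)
  moreover have "ennreal (cmod (u 0 * f (\<phi> 0))) \<le> 69 * ennreal (cmod (u 0) * log_weight (\<phi> 0))"
  proof -
    have "0 \<le> log_weight (\<phi> 0)" using log_weight_ge[OF \<phi>D, of 0] by simp
    then have "cmod (u 0 * f (\<phi> 0)) \<le> 69 * (cmod (u 0) * log_weight (\<phi> 0))"
      using mult_left_mono[of "cmod (f (\<phi> 0))" "69 * log_weight (\<phi> 0)" "cmod (u 0)"] fl[OF \<phi>D, of 0]
      by (simp add: norm_mult mult_ac)
    then have "ennreal (cmod (u 0 * f (\<phi> 0))) \<le> ennreal (69 * (cmod (u 0) * log_weight (\<phi> 0)))"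
      by (rule ennreal_leI)
    then show ?thesis by (simp add: ennreal_mult')
  qed
  ultimately have "bloch_norm (\<lambda>z. u z * f (\<phi> z))
      \<le> 69 * ennreal (cmod (u 0) * log_weight (\<phi> 0)) + (69 * \<beta> + 69 * \<alpha>)"
    unfolding bloch_norm_def by (rule add_mono[rotated])
  then show "bloch_norm (\<lambda>z. u z * f (\<phi> z)) \<le> 69 * (ennreal (cmod (u 0) * log_weight (\<phi> 0))
      + (SUP a\<in>unit_disc. alpha_fn u \<phi> a) + (SUP a\<in>unit_disc. beta_fn u \<phi> a))"
    by (simp add: \<alpha>_def \<beta>_def distrib_left add_ac)
qed

section \<open>The lower bound\<close>

lemma one_le_powr_one_minus_norm: "z \<in> unit_disc \<Longrightarrow> 1 \<le> (1 - cmod z) powr (-1/4)"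
  using powr_mono2'[of "-1/4" "1 - cmod z" 1] by (simp add: unit_disc_def)

text \<open>Division by \<open>B\<close> moves \<open>f\<close> into the unit ball over which
  \<open>wco_norm\<close> is a supremum. Value and derivative are kept together so that either can
  be read off.\<close>

lemma weighted_comp_bloch_bound:
  assumes u: "u holomorphic_on unit_disc" and \<phi>: "self_map \<phi>" and f: "f holomorphic_on unit_disc"
    and x: "wco_norm u \<phi> \<le> ennreal x" "x \<ge> 0" and B: "B > 0"
    and fB: "\<And>z. z \<in> unit_disc \<Longrightarrow> cmod (f 0) + (1 - (cmod z)\<^sup>2) * cmod (deriv f z) \<le> B"
    and z: "z \<in> unit_disc"
  shows "cmod (u 0 * f (\<phi> 0)) + (1 - (cmod z)\<^sup>2) * cmod (deriv (\<lambda>z. u z * f (\<phi> z)) z) \<le> B * x"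
proof -
  define g where "g = (\<lambda>z. f z / of_real B)"
  have g: "g holomorphic_on unit_disc" unfolding g_def using B by (intro holomorphic_intros f) auto
  have dg: "deriv g z = deriv f z / of_real B" if "z \<in> unit_disc" for z
    unfolding g_def
    by (rule DERIV_imp_deriv[OF DERIV_cdivide[OF holomorphic_derivI[OF f open_unit_disc that]]])
  have "cmod (g 0) + (1 - (cmod z)\<^sup>2) * cmod (deriv g z) \<le> 1" if z: "z \<in> unit_disc" for z
  proof -
    have "cmod (g 0) + (1 - (cmod z)\<^sup>2) * cmod (deriv g z)
        = (cmod (f 0) + (1 - (cmod z)\<^sup>2) * cmod (deriv f z)) / B"
      using B by (simp add: dg[OF z] norm_divide add_divide_distrib) (simp add: g_def norm_divide)
    also have "\<dots> \<le> 1" using fB[OF z] B by simp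
    finally show ?thesis .
  qed
  then have "bloch_norm g \<le> 1" using bloch_norm_le_iff[of 1 g] by simp
  then have "bloch_norm (\<lambda>z. u z * g (\<phi> z)) \<le> wco_norm u \<phi>"
    unfolding wco_norm_def using g by (intro SUP_upper) simp
  then have bl: "bloch_norm (\<lambda>z. u z * g (\<phi> z)) \<le> ennreal x" using x(1) by order
  have le: "cmod (u 0 * g (\<phi> 0)) + (1 - (cmod z)\<^sup>2) * cmod (deriv (\<lambda>z. u z * g (\<phi> z)) z) \<le> x"
    using bspec[OF iffD1[OF bloch_norm_le_iff[OF x(2)] bl] z] .
  have \<phi>z: "\<phi> z \<in> unit_disc" using \<phi> z by (auto simp: self_map_def)
  have "deriv (\<lambda>z. u z * g (\<phi> z)) z = deriv (\<lambda>z. u z * f (\<phi> z)) z / of_real B"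
    unfolding deriv_weighted_comp[OF u \<phi> g z] deriv_weighted_comp[OF u \<phi> f z] dg[OF \<phi>z]
    by (simp add: g_def add_divide_distrib)
  then have "(cmod (u 0 * f (\<phi> 0)) + (1 - (cmod z)\<^sup>2) * cmod (deriv (\<lambda>z. u z * f (\<phi> z)) z)) / B \<le> x"
    using le B by (simp add: g_def norm_divide norm_mult add_divide_distrib)
  then show ?thesis using B by (simp add: field_simps)
qed

text \<open>With \<open>F z = log (2 / (1 - cnj b z))\<close> and \<open>L = F b\<close>, the function \<open>2 F - F\<^sup>2 / L\<close>
  has value \<open>L\<close> and vanishing derivative at \<open>b\<close>.\<close>

lemma bloch_log_test_function:
  assumes b: "b \<in> unit_disc"
  obtains h where "h holomorphic_on unit_disc" "h b = of_real (log_weight b)" "deriv h b = 0"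
    "\<And>z. z \<in> unit_disc \<Longrightarrow> cmod (h 0) + (1 - (cmod z)\<^sup>2) * cmod (deriv h z) \<le> 40"
proof -
  define L where "L = log_weight b"
  have L: "2 / 3 \<le> L" using log_weight_ge[OF b] by (simp add: L_def)
  have b1: "cmod b < 1" using b by (simp add: unit_disc_def)
  \<comment> \<open>Splitting the logarithm of the quotient as a difference keeps \<open>F\<close>
    analytic, since \<open>1 - cnj b * z\<close> has positive real part on the disc.\<close>
  define F where "F = (\<lambda>z. of_real (ln 2) - Ln (1 - cnj b * z))"
  define F' where "F' = (\<lambda>z. cnj b / (1 - cnj b * z))"
  define h where "h = (\<lambda>z. 2 * F z - (F z)\<^sup>2 / of_real L)"
  have small: "cmod (cnj b * z) \<le> cmod b" "cmod (cnj b * z) \<le> cmod z" if "z \<in> unit_disc" for z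
    using that b1 by (auto simp: norm_mult unit_disc_def mult_left_le mult_left_le_one_le)
  have Re: "Re (1 - cnj b * z) > 0" if "z \<in> unit_disc" for z
    using small(1)[OF that] b1 complex_Re_le_cmod[of "cnj b * z"] by simp
  have nonp: "1 - cnj b * z \<notin> \<real>\<^sub>\<le>\<^sub>0" if "z \<in> unit_disc" for z
    using Re[OF that] by (auto simp: complex_nonpos_Reals_iff)
  have dF: "(F has_field_derivative F' z) (at z)" if "z \<in> unit_disc" for z
    unfolding F_def F'_def using nonp[OF that]
    by (auto intro!: derivative_eq_intros simp: divide_simps)
  have dh: "(h has_field_derivative 2 * F' z - 2 * F z * F' z / of_real L) (at z)" if "z \<in> unit_disc" for z
    unfolding h_def using L dF[OF that]
    by (auto intro!: derivative_eq_intros simp: field_simps)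
  have Fb: "F b = of_real L"
  proof -
    have "1 - cnj b * b = of_real (1 - (cmod b)\<^sup>2)"
      using complex_norm_square[of b] by (simp add: mult.commute)
    then have "Ln (1 - cnj b * b) = of_real (ln (1 - (cmod b)\<^sup>2))"
      using one_minus_norm_sq_pos[OF b] by (simp only: Ln_of_real)
    then have "F b = of_real (ln 2 - ln (1 - (cmod b)\<^sup>2))"
      by (simp only: F_def of_real_diff)
    then show ?thesis
      using one_minus_norm_sq_pos[OF b] by (simp add: L_def ln_div)
  qed
  have F0: "F 0 = of_real (ln 2)" by (simp add: F_def)
  \<comment> \<open>\<open>F\<close> is comparable to \<open>L\<close> at worst, so the factor
    \<open>1 - F z / L\<close> in the derivative of \<open>h\<close> is bounded uniformly in
    \<open>b\<close>. The 8 is 2 from the real part plus 6 from the imaginary part.\<close>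
  have Fbound: "cmod (F z) \<le> 8 * L" if z: "z \<in> unit_disc" for z
  proof -
    let ?w = "1 - cnj b * z"
    have w0: "?w \<noteq> 0" using nonp[OF z] by auto
    have w2: "cmod ?w \<le> 2"
      using norm_triangle_ineq4[of 1 "cnj b * z"] small(1)[OF z] b1 by simp
    have w1: "1 - cmod b \<le> cmod ?w"
      using norm_triangle_ineq2[of 1 "cnj b * z"] small(1)[OF z] by simp
    have ReF: "Re (F z) = ln (2 / cmod ?w)"
      using w0 by (simp add: F_def ln_div Re_Ln)
    have "0 \<le> Re (F z)" unfolding ReF using w0 w2 by (intro ln_ge_zero) (simp add: field_simps)
    moreover have "Re (F z) \<le> 2 * L"
    proof -
      have "1 - (cmod b)\<^sup>2 \<le> 2 * (1 - cmod b)"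
        using zero_le_power2[of "1 - cmod b"] by (simp add: power2_diff)
      also have "\<dots> \<le> 2 * cmod ?w" using w1 by simp
      finally have "(1 - (cmod b)\<^sup>2) / 2 \<le> cmod ?w" by simp
      then have "2 / cmod ?w \<le> 2 / ((1 - (cmod b)\<^sup>2) / 2)"
        using one_minus_norm_sq_pos[OF b] by (intro frac_le) auto
      also have "\<dots> = 2 * (2 / (1 - (cmod b)\<^sup>2))" by simp
      finally have "ln (2 / cmod ?w) \<le> ln (2 * (2 / (1 - (cmod b)\<^sup>2)))"
        using w0 by (intro ln_mono) (auto intro!: divide_pos_pos)
      also have "\<dots> = ln 2 + L"
        using one_minus_norm_sq_pos[OF b] unfolding L_def by (intro ln_mult_pos) auto
      also have "ln 2 \<le> L"
        unfolding L_def using one_minus_norm_sq_pos[OF b] by (intro ln_mono) (auto simp: field_simps)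
      finally show ?thesis unfolding ReF by simp
    qed
    \<comment> \<open>The argument is at most \<open>pi\<close>, which is below 4 = 6 *
      (2/3).\<close>
    moreover have "\<bar>Im (F z)\<bar> \<le> 6 * L"
    proof -
      have "\<bar>Im (F z)\<bar> = \<bar>Im (Ln ?w)\<bar>" by (simp add: F_def)
      also have "\<dots> \<le> pi" using Im_Ln_le_pi[OF w0] mpi_less_Im_Ln[OF w0] by linarith
      finally show ?thesis using pi_less_4 L by linarith
    qed
    moreover have "cmod (F z) \<le> \<bar>Re (F z)\<bar> + \<bar>Im (F z)\<bar>" by (rule cmod_le)
    ultimately show ?thesis by linarith
  qed
  \<comment> \<open>The lower bound \<open>1 - cmod z\<close> for the denominator makes this
    independent of \<open>b\<close>.\<close>
  have F'bound: "(1 - (cmod z)\<^sup>2) * cmod (F' z) \<le> 2" if z: "z \<in> unit_disc" for z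
  proof -
    let ?w = "1 - cnj b * z"
    have w1: "1 - cmod z \<le> cmod ?w"
      using norm_triangle_ineq2[of 1 "cnj b * z"] small(2)[OF z] by simp
    have w0: "0 < cmod ?w" using nonp[OF z] by auto
    have "1 - (cmod z)\<^sup>2 \<le> 2 * (1 - cmod z)"
      using zero_le_power2[of "1 - cmod z"] by (simp add: power2_diff)
    then have "(1 - (cmod z)\<^sup>2) * cmod b \<le> 2 * cmod ?w * 1"
      using w1 b1 one_minus_norm_sq_pos[OF z] by (intro mult_mono) auto
    then show ?thesis using w0 by (simp add: F'_def norm_divide pos_divide_le_eq)
  qed
  show ?thesis
  proof
    show "h holomorphic_on unit_disc" using dh by (auto simp: holomorphic_on_open)
    have "h b = of_real L"
      using L by (simp add: h_def Fb power2_eq_square)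
    then show "h b = of_real (log_weight b)" by (simp only: L_def)
    show "deriv h b = 0" using DERIV_imp_deriv[OF dh[OF b]] L by (simp add: Fb)
    fix z assume z: "z \<in> unit_disc"
    have "deriv h z = 2 * F' z * (1 - F z / of_real L)"
      using DERIV_imp_deriv[OF dh[OF z]] by (simp add: algebra_simps)
    then have "(1 - (cmod z)\<^sup>2) * cmod (deriv h z) = 2 * ((1 - (cmod z)\<^sup>2) * cmod (F' z)) * cmod (1 - F z / of_real L)"
      by (simp add: norm_mult)
    also have "\<dots> \<le> 2 * 2 * (1 + 8)"
    proof (intro mult_mono F'bound z order_refl)
      have "cmod (1 - F z / of_real L) \<le> 1 + cmod (F z) / L"
        using norm_triangle_ineq4[of 1 "F z / of_real L"] L by (simp add: norm_divide)
      also have "cmod (F z) / L \<le> 8" using Fbound[OF z] L by (simp add: field_simps)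
      finally show "cmod (1 - F z / of_real L) \<le> 1 + 8" by simp
    qed (use one_minus_norm_sq_pos[OF z] in auto)
    finally have "(1 - (cmod z)\<^sup>2) * cmod (deriv h z) \<le> 36" by simp
    \<comment> \<open>At 0 the two terms of \<open>h\<close> contribute at most 2 and 3/2. With 36
      from the derivative this gives 40.\<close>
    moreover have "cmod (h 0) \<le> 4"
    proof -
      have "h 0 = of_real (2 * ln 2 - (ln 2)\<^sup>2 / L)" by (simp add: h_def F0)
      then have "cmod (h 0) = \<bar>2 * ln 2 - (ln 2)\<^sup>2 / L\<bar>" by (simp only: norm_of_real)
      also have "\<dots> \<le> \<bar>2 * ln 2\<bar> + \<bar>(ln 2)\<^sup>2 / L\<bar>" by (rule abs_triangle_ineq4)
      also have "\<bar>(ln 2)\<^sup>2 / L\<bar> = (ln 2)\<^sup>2 / L" using L by simp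
      also have "(ln 2)\<^sup>2 / L \<le> 1 / (2 / 3)"
        using L ln_2_less_1 by (intro frac_le power_le_one) auto
      also have "\<bar>2 * ln 2 :: real\<bar> \<le> 2" using ln_2_less_1 by simp
      finally show ?thesis by simp
    qed
    ultimately show "cmod (h 0) + (1 - (cmod z)\<^sup>2) * cmod (deriv h z) \<le> 40" by linarith
  qed
qed

text \<open>The vanishing derivative of the test function at \<phi>\<open>(a)\<close> kills the
  second term of the product rule and isolates \<open>deriv u a\<close>.\<close>

lemma deriv_weight_lower_bound:
  assumes u: "u holomorphic_on unit_disc" and \<phi>: "self_map \<phi>"
    and x: "wco_norm u \<phi> \<le> ennreal x" "x \<ge> 0" and a: "a \<in> unit_disc"
  shows "log_weight (\<phi> a) * ((1 - (cmod a)\<^sup>2) * cmod (deriv u a)) \<le> 40 * x"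
proof -
  have b: "\<phi> a \<in> unit_disc" using \<phi> a by (auto simp: self_map_def)
  obtain h where h: "h holomorphic_on unit_disc" "h (\<phi> a) = of_real (log_weight (\<phi> a))" "deriv h (\<phi> a) = 0"
    "\<And>z. z \<in> unit_disc \<Longrightarrow> cmod (h 0) + (1 - (cmod z)\<^sup>2) * cmod (deriv h z) \<le> 40"
    using bloch_log_test_function[OF b] by blast
  have "(1 - (cmod a)\<^sup>2) * cmod (deriv (\<lambda>z. u z * h (\<phi> z)) a) \<le> 40 * x"
    using weighted_comp_bloch_bound[OF u \<phi> h(1) x zero_less_numeral h(4) a]
      norm_ge_zero[of "u 0 * h (\<phi> 0)"] by linarith
  moreover have "deriv (\<lambda>z. u z * h (\<phi> z)) a = deriv u a * of_real (log_weight (\<phi> a))"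
    using deriv_weighted_comp[OF u \<phi> h(1) a] h(2,3) by simp
  moreover have "0 \<le> log_weight (\<phi> a)" using log_weight_ge[OF b] by linarith
  ultimately show ?thesis by (simp add: norm_mult mult_ac)
qed

text \<open>The same test function for the point \<phi>\<open>(0)\<close>, now reading off the value
  at the origin.\<close>

lemma value_at_0_lower_bound:
  assumes u: "u holomorphic_on unit_disc" and \<phi>: "self_map \<phi>"
    and x: "wco_norm u \<phi> \<le> ennreal x" "x \<ge> 0"
  shows "cmod (u 0) * log_weight (\<phi> 0) \<le> 40 * x"
proof -
  have b: "\<phi> 0 \<in> unit_disc" using \<phi> by (auto simp: self_map_def)
  obtain h where h: "h holomorphic_on unit_disc" "h (\<phi> 0) = of_real (log_weight (\<phi> 0))"
    "\<And>z. z \<in> unit_disc \<Longrightarrow> cmod (h 0) + (1 - (cmod z)\<^sup>2) * cmod (deriv h z) \<le> 40"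
    using bloch_log_test_function[OF b] by blast
  have "0 \<le> (1 - (cmod 0)\<^sup>2) * cmod (deriv (\<lambda>z. u z * h (\<phi> z)) 0)" by simp
  then have "cmod (u 0 * h (\<phi> 0)) \<le> 40 * x"
    using weighted_comp_bloch_bound[OF u \<phi> h(1) x zero_less_numeral h(3) zero_in_unit_disc] by linarith
  moreover have "0 \<le> log_weight (\<phi> 0)" using log_weight_ge[OF b] by linarith
  ultimately show ?thesis by (simp add: h(2) norm_mult)
qed

text \<open>An automorphism changes the distance to the boundary by a bounded multiple of
  \<open>1 / (1 - (cmod w)\<^sup>2)\<close>, so the weights differ additively by a logarithm, which
  a power dominates. The exponent 1/4 is chosen below 1/2 to make the resulting bound square
  integrable.\<close>

lemma log_weight_disc_aut_le:
  assumes b: "b \<in> unit_disc" and w: "w \<in> unit_disc"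
  shows "log_weight b \<le> 9 * log_weight (disc_aut b w) * (1 - cmod w) powr (-1/4)"
proof -
  define t where "t = (1 - cmod w) powr (-1/4)"
  define \<Lambda> where "\<Lambda> = log_weight (disc_aut b w)"
  have w1: "0 < 1 - cmod w" using w by (simp add: unit_disc_def)
  note pos = one_minus_norm_sq_pos[OF b] one_minus_norm_sq_pos[OF w]
    one_minus_norm_sq_pos[OF disc_aut_in_unit_disc[OF b w]]
  have \<Lambda>: "2 / 3 \<le> \<Lambda>" unfolding \<Lambda>_def by (rule log_weight_ge[OF disc_aut_in_unit_disc[OF b w]])
  have t1: "1 \<le> t"
    unfolding t_def by (rule one_le_powr_one_minus_norm[OF w])
  have "1 - cmod w \<le> cmod (1 - cnj b * w)"
  proof -
    have "cmod (cnj b * w) \<le> cmod w"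
      using b by (simp add: norm_mult unit_disc_def mult_left_le_one_le)
    then show ?thesis using norm_triangle_ineq2[of 1 "cnj b * w"] by simp
  qed
  moreover have "1 - (cmod w)\<^sup>2 \<le> 2 * (1 - cmod w)"
    using zero_le_power2[of "1 - cmod w"] by (simp add: power2_diff)
  ultimately have "((1 - (cmod w)\<^sup>2) / 2)\<^sup>2 \<le> (cmod (1 - cnj b * w))\<^sup>2"
    using pos by (intro power_mono) auto
  then have "(1 - (cmod b)\<^sup>2) * (1 - (cmod w)\<^sup>2) / (cmod (1 - cnj b * w))\<^sup>2
      \<le> (1 - (cmod b)\<^sup>2) * (1 - (cmod w)\<^sup>2) / ((1 - (cmod w)\<^sup>2) / 2)\<^sup>2"
    using pos by (intro frac_le) auto
  also have "\<dots> = 4 * (1 - (cmod b)\<^sup>2) / (1 - (cmod w)\<^sup>2)"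
  proof -
    have "B * W / (W / 2)\<^sup>2 = 4 * B / W" if "W \<noteq> 0" for B W :: real
      using that by (simp add: field_simps power2_eq_square)
    then show ?thesis using pos by simp
  qed
  finally have le: "1 - (cmod (disc_aut b w))\<^sup>2 \<le> 4 * (1 - (cmod b)\<^sup>2) / (1 - (cmod w)\<^sup>2)"
    unfolding one_minus_norm_disc_aut[OF b w] .
  have gen: "2 / B \<le> 2 / S * (4 / W)" if "S \<le> 4 * B / W" "0 < S" "0 < B" "0 < W" for S B W :: real
    using that by (simp add: field_simps)
  have "log_weight b \<le> ln (2 / (1 - (cmod (disc_aut b w))\<^sup>2) * (4 / (1 - (cmod w)\<^sup>2)))"
    using gen[OF le] pos by (intro ln_mono) auto
  also have "\<dots> = \<Lambda> + ln (4 / (1 - (cmod w)\<^sup>2))"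
    unfolding \<Lambda>_def using pos by (intro ln_mult_pos) auto
  \<comment> \<open>By definition of \<open>t\<close>, \<open>- ln (1 - cmod w)\<close> is
    \<open>4 * ln t\<close>; then \<open>ln t \<le> t - 1\<close> leaves a spare -4 that absorbs
    \<open>2 * ln 2\<close>.\<close>
  also have "ln (4 / (1 - (cmod w)\<^sup>2)) \<le> 4 * t"
  proof -
    have "1 - cmod w \<le> 1 - (cmod w)\<^sup>2" using w1 by (simp add: power2_eq_square mult_left_le)
    then have "4 / (1 - (cmod w)\<^sup>2) \<le> 4 / (1 - cmod w)" using w1 by (intro frac_le) auto
    then have "ln (4 / (1 - (cmod w)\<^sup>2)) \<le> ln (4 / (1 - cmod w))"
      using pos by (intro ln_mono) auto
    also have "\<dots> = ln (2 * 2) - ln (1 - cmod w)" using w1 by (simp add: ln_div)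
    also have "\<dots> = 2 * ln 2 + 4 * ln t"
      using w1 ln_mult_pos[of 2 "2::real"] by (simp add: t_def ln_powr)
    finally have "ln (4 / (1 - (cmod w)\<^sup>2)) \<le> 2 * ln 2 + 4 * ln t" .
    moreover have "ln t \<le> t - 1" using t1 by (intro ln_le_minus_one) auto
    ultimately show ?thesis using ln_2_less_1 by linarith
  qed
  \<comment> \<open>From \<Lambda> at least 2/3 comes \<open>4 * t \<le> 6 * \<Lambda> * t\<close>,
    and \<open>t \<ge> 1\<close> handles the first term; the sum is
    \<open>7 * \<Lambda> * t\<close>.\<close>
  also have "\<Lambda> + 4 * t \<le> 9 * \<Lambda> * t"
  proof -
    have "2 / 3 * t \<le> \<Lambda> * t" "\<Lambda> * 1 \<le> \<Lambda> * t"
      using \<Lambda> t1 by (intro mult_right_mono mult_left_mono; simp)+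
    then show ?thesis using \<Lambda> t1 unfolding mult.assoc by linarith
  qed
  finally show ?thesis by (simp add: \<Lambda>_def t_def)
qed

text \<open>The pointwise bound carries the weight at each point, whereas \<open>beta_fn\<close>
  freezes it at \<phi>\<open>(a)\<close>. Exchanging the weights costs a power of
  \<open>1 - cmod z\<close>, harmless after radial integration. The constant is 40 * 9 * 4 *
  3.\<close>

lemma beta_fn_lower_bound:
  assumes u: "u holomorphic_on unit_disc" and \<phi>: "self_map \<phi>"
    and x: "wco_norm u \<phi> \<le> ennreal x" "x \<ge> 0" and a: "a \<in> unit_disc"
  shows "beta_fn u \<phi> a \<le> ennreal (4320 * x)"
proof -
  have \<phi>h: "\<phi> holomorphic_on unit_disc" and \<phi>D: "\<And>z. z \<in> unit_disc \<Longrightarrow> \<phi> z \<in> unit_disc"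
    using \<phi> by (auto simp: self_map_def)
  note b = \<phi>D[OF a]
  define \<psi> where "\<psi> = (\<lambda>z. disc_aut (\<phi> a) (\<phi> (disc_aut a z)))"
  define v where "v = (\<lambda>z. u (disc_aut a z))"
  define L where "L = log_weight (\<phi> a)"
  have L: "0 < L" using log_weight_ge[OF b] by (simp add: L_def)
  have aD: "disc_aut a z \<in> unit_disc" if "z \<in> unit_disc" for z
    using a that by (rule disc_aut_in_unit_disc)
  have v: "v holomorphic_on unit_disc"
    unfolding v_def by (intro holomorphic_on_comp_unit_disc[OF u] disc_aut_holomorphic a aD)
  have \<psi>D: "\<psi> z \<in> unit_disc" if "z \<in> unit_disc" for z
    unfolding \<psi>_def by (intro disc_aut_in_unit_disc b \<phi>D aD that)
  have \<psi>h: "\<psi> holomorphic_on unit_disc"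
    unfolding \<psi>_def
    by (intro holomorphic_on_comp_unit_disc[OF disc_aut_holomorphic] holomorphic_on_comp_unit_disc[OF \<phi>h]
        disc_aut_holomorphic a b aD \<phi>D)
  \<comment> \<open>Schwarz's lemma applies because recentring gives \<psi>\<open>(0) = 0\<close>.
    It replaces \<psi>\<open>(z)\<close> by \<open>z\<close> in the negative power below.\<close>
  have \<psi>le: "cmod (\<psi> z) \<le> cmod z" if "z \<in> unit_disc" for z
    using \<psi>h \<psi>D that by (intro Schwarz_Lemma(1)) (auto simp: unit_disc_def \<psi>_def)
  have vb: "(1 - (cmod z)\<^sup>2) * cmod (deriv v z) \<le> 360 * x / L * (1 - cmod z) powr (-1/4)"
    if z: "z \<in> unit_disc" for z
  proof -
    define \<Lambda> where "\<Lambda> = log_weight (\<phi> (disc_aut a z))"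
    have \<Lambda>: "0 < \<Lambda>" using log_weight_ge[OF \<phi>D[OF aD[OF z]]] by (simp add: \<Lambda>_def)
    \<comment> \<open>The involution recovers the image point from \<psi>, which puts the comparison
      of weights in the form of \<open>log_weight_disc_aut_le\<close>.\<close>
    have \<Lambda>eq: "disc_aut (\<phi> a) (\<psi> z) = \<phi> (disc_aut a z)"
      unfolding \<psi>_def by (intro disc_aut_disc_aut b \<phi>D aD z)
    have "L \<le> 9 * \<Lambda> * (1 - cmod (\<psi> z)) powr (-1/4)"
      using log_weight_disc_aut_le[OF b \<psi>D[OF z]] by (simp add: \<Lambda>eq L_def \<Lambda>_def)
    also have "\<dots> \<le> 9 * \<Lambda> * (1 - cmod z) powr (-1/4)"
      using \<psi>le[OF z] z \<Lambda> by (intro mult_left_mono powr_mono2') (auto simp: unit_disc_def)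
    finally have LL: "L \<le> 9 * \<Lambda> * (1 - cmod z) powr (-1/4)" .
    define D where "D = (1 - (cmod z)\<^sup>2) * cmod (deriv v z)"
    have D0: "0 \<le> D" using one_minus_norm_sq_pos[OF z] by (simp add: D_def)
    have "\<Lambda> * D \<le> 40 * x"
      using deriv_weight_lower_bound[OF u \<phi> x aD[OF z]] norm_deriv_comp_disc_aut[OF u a z]
      by (simp add: \<Lambda>_def D_def v_def)
    have "L * D \<le> 9 * \<Lambda> * (1 - cmod z) powr (-1/4) * D"
      using LL D0 by (rule mult_right_mono)
    also have "\<dots> = 9 * (1 - cmod z) powr (-1/4) * (\<Lambda> * D)" by simp
    also have "\<dots> \<le> 9 * (1 - cmod z) powr (-1/4) * (40 * x)"
      using \<open>\<Lambda> * D \<le> 40 * x\<close> by (intro mult_left_mono) auto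
    finally have "D \<le> 360 * x / L * (1 - cmod z) powr (-1/4)" using L by (simp add: field_simps)
    then show ?thesis by (simp only: D_def)
  qed
  have "L * cmod (v z - v 0) \<le> 1440 * x * (1 - cmod z) powr (-1/4)" if z: "z \<in> unit_disc" for z
  proof -
    have "cmod (v z - v 0) \<le> 4 * (360 * x / L) * (1 - cmod z) powr (-1/4)"
      using L x(2) by (intro norm_diff_le_powr[OF v vb _ z]) auto
    then show ?thesis using L by (simp add: field_simps)
  qed
  then have "ennreal L * A2_norm (\<lambda>z. v z - v 0) \<le> ennreal (3 * (1440 * x))"
    using L x(2) by (intro A2_norm_le_of_growth) auto
  then show ?thesis by (simp add: beta_fn_def L_def v_def)
qed

text \<open>The product \<open>u a * \<psi> z\<close> is expressed through increments of
  \<open>u\<close> and of \<open>g\<close>, the images under the operator of 1 and of an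
  automorphism. Both images are Bloch functions with seminorm controlled by
  \<open>x\<close>.\<close>

lemma alpha_fn_lower_bound:
  assumes u: "u holomorphic_on unit_disc" and \<phi>: "self_map \<phi>"
    and x: "wco_norm u \<phi> \<le> ennreal x" "x \<ge> 0" and a: "a \<in> unit_disc"
  shows "alpha_fn u \<phi> a \<le> ennreal (36 * x)"
proof -
  have \<phi>h: "\<phi> holomorphic_on unit_disc" and \<phi>D: "\<And>z. z \<in> unit_disc \<Longrightarrow> \<phi> z \<in> unit_disc"
    using \<phi> by (auto simp: self_map_def)
  note b = \<phi>D[OF a]
  have aD: "disc_aut a z \<in> unit_disc" if "z \<in> unit_disc" for z
    using a that by (rule disc_aut_in_unit_disc)
  define g where "g = (\<lambda>z. u z * disc_aut (\<phi> a) (\<phi> z))"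
  define \<psi> where "\<psi> = (\<lambda>z. disc_aut (\<phi> a) (\<phi> (disc_aut a z)))"
  have \<psi>1: "cmod (\<psi> z) \<le> 1" if "z \<in> unit_disc" for z
    using disc_aut_in_unit_disc[OF b \<phi>D[OF aD[OF that]]] by (simp add: \<psi>_def unit_disc_def)
  \<comment> \<open>The power weight is at least 1, so a constant Bloch bound fits
    \<open>norm_diff_le_powr\<close>.\<close>
  have growth: "cmod (f (disc_aut a z) - f a) \<le> 4 * K * (1 - cmod z) powr (-1/4)"
    if f: "f holomorphic_on unit_disc" and K: "K \<ge> 0" and z: "z \<in> unit_disc"
      and fK: "\<And>z. z \<in> unit_disc \<Longrightarrow> (1 - (cmod z)\<^sup>2) * cmod (deriv f z) \<le> K" for f K z
  proof -
    have "(1 - (cmod w)\<^sup>2) * cmod (deriv (\<lambda>z. f (disc_aut a z)) w) \<le> K * (1 - cmod w) powr (-1/4)"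
      if w: "w \<in> unit_disc" for w
      unfolding norm_deriv_comp_disc_aut[OF f a w]
      using fK[OF aD[OF w]] mult_left_mono[OF one_le_powr_one_minus_norm[OF w] K] by simp
    then show ?thesis
      using norm_diff_le_powr[of "\<lambda>z. f (disc_aut a z)" K z] K z
        holomorphic_on_comp_unit_disc[OF f disc_aut_holomorphic[OF a] aD] by simp
  qed
  have uK: "(1 - (cmod z)\<^sup>2) * cmod (deriv u z) \<le> x" if z: "z \<in> unit_disc" for z
  proof -
    \<comment> \<open>The constant test function 1 has Bloch norm 1 and shows that \<open>u\<close>
      itself is Bloch.\<close>
    have "cmod (u 0 * 1) + (1 - (cmod z)\<^sup>2) * cmod (deriv (\<lambda>z. u z * 1) z) \<le> 1 * x"
      by (rule weighted_comp_bloch_bound[OF u \<phi> _ x _ _ z, where f = "\<lambda>_. 1"]) auto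
    then have "cmod (u 0) + (1 - (cmod z)\<^sup>2) * cmod (deriv u z) \<le> x" by (simp only: mult_1_right mult_1)
    then show ?thesis using norm_ge_zero[of "u 0"] by linarith
  qed
  have gK: "(1 - (cmod z)\<^sup>2) * cmod (deriv g z) \<le> 2 * x" if z: "z \<in> unit_disc" for z
  proof -
    \<comment> \<open>The value at 0 and the weighted derivative of an automorphism are each at most
      1.\<close>
    have "cmod (disc_aut (\<phi> a) 0) + (1 - (cmod z)\<^sup>2) * cmod (deriv (disc_aut (\<phi> a)) z) \<le> 2"
      if "z \<in> unit_disc" for z
      unfolding norm_deriv_disc_aut[OF b that] disc_aut_0
      using norm_less_1_of_unit_disc[OF b] zero_le_power2[of "cmod (disc_aut (\<phi> a) z)"] by linarith
    from weighted_comp_bloch_bound[OF u \<phi> disc_aut_holomorphic[OF b] x zero_less_numeral this z]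
    show ?thesis unfolding g_def using norm_ge_zero[of "u 0 * disc_aut (\<phi> a) (\<phi> 0)"] by linarith
  qed
  have gh: "g holomorphic_on unit_disc"
    unfolding g_def
    by (intro holomorphic_on_mult u holomorphic_on_comp_unit_disc[OF disc_aut_holomorphic] \<phi>h b \<phi>D)
  have "cmod (u a) * cmod (\<psi> z) \<le> 12 * x * (1 - cmod z) powr (-1/4)" if z: "z \<in> unit_disc" for z
  proof -
    \<comment> \<open>The identity uses \<open>g a = 0\<close>, which holds because
      \<open>disc_aut\<close> at \<phi>\<open>(a)\<close> sends that point to 0.\<close>
    have "u a * \<psi> z = (g (disc_aut a z) - g a) - (u (disc_aut a z) - u a) * \<psi> z"
      by (simp add: g_def \<psi>_def algebra_simps)
    then have "cmod (u a * \<psi> z) \<le> cmod (g (disc_aut a z) - g a) + cmod ((u (disc_aut a z) - u a) * \<psi> z)"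
      by (metis norm_triangle_ineq4)
    also have "cmod ((u (disc_aut a z) - u a) * \<psi> z) \<le> cmod (u (disc_aut a z) - u a)"
      unfolding norm_mult using \<psi>1[OF z] by (simp add: mult_left_le)
    also have "\<dots> \<le> 4 * x * (1 - cmod z) powr (-1/4)" by (rule growth[OF u x(2) z uK])
    also have "cmod (g (disc_aut a z) - g a) \<le> 4 * (2 * x) * (1 - cmod z) powr (-1/4)"
      using x(2) by (intro growth[OF gh _ z gK]) auto
    finally show ?thesis by (simp add: norm_mult)
  qed
  then have "ennreal (cmod (u a)) * A2_norm \<psi> \<le> ennreal (3 * (12 * x))"
    using x(2) by (intro A2_norm_le_of_growth) auto
  then show ?thesis by (simp add: alpha_fn_def \<psi>_def o_def)
qed

lemma wco_norm_lower_bound: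
  assumes u: "u holomorphic_on unit_disc" and \<phi>: "self_map \<phi>"
  shows "ennreal (1 / 5000) * (ennreal (cmod (u 0) * log_weight (\<phi> 0))
    + (SUP a\<in>unit_disc. alpha_fn u \<phi> a) + (SUP a\<in>unit_disc. beta_fn u \<phi> a)) \<le> wco_norm u \<phi>"
proof (cases "wco_norm u \<phi>")
  case (real x)
  then have x: "wco_norm u \<phi> \<le> ennreal x" "x \<ge> 0" by auto
  have "ennreal (cmod (u 0) * log_weight (\<phi> 0))
    + (SUP a\<in>unit_disc. alpha_fn u \<phi> a) + (SUP a\<in>unit_disc. beta_fn u \<phi> a)
    \<le> ennreal (40 * x) + ennreal (36 * x) + ennreal (4320 * x)"
    by (intro add_mono SUP_least ennreal_leI value_at_0_lower_bound alpha_fn_lower_bound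
        beta_fn_lower_bound u \<phi> x)
  \<comment> \<open>40 + 36 + 4320 = 4396, rounded up to 5000 in the constant.\<close>
  also have "\<dots> = ennreal (4396 * x)" using x(2) by (simp flip: ennreal_plus)
  finally have "ennreal (1 / 5000) * (ennreal (cmod (u 0) * log_weight (\<phi> 0))
    + (SUP a\<in>unit_disc. alpha_fn u \<phi> a) + (SUP a\<in>unit_disc. beta_fn u \<phi> a))
    \<le> ennreal (1 / 5000) * ennreal (4396 * x)" by (rule mult_left_mono) simp
  also have "\<dots> = ennreal (4396 / 5000 * x)" using x(2) by (subst ennreal_mult'[symmetric]) auto
  also have "\<dots> \<le> ennreal x" using x(2) by (intro ennreal_leI) auto
  finally show ?thesis using real by simp
qed simp

theorem theorem2p8:
  shows "\<exists>c C. c > 0 \<and> C > 0 \<and>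
    (\<forall>u \<phi>. u holomorphic_on unit_disc \<and> self_map \<phi> \<longrightarrow>
      (let R = ennreal (cmod (u 0) * ln (2 / (1 - (cmod (\<phi> 0))\<^sup>2)))
               + (SUP a\<in>unit_disc. alpha_fn u \<phi> a) + (SUP a\<in>unit_disc. beta_fn u \<phi> a)
       in ennreal c * R \<le> wco_norm u \<phi> \<and> wco_norm u \<phi> \<le> ennreal C * R))"
proof (rule exI[of _ "1 / 5000"], rule exI[of _ 69], intro conjI allI impI)
  fix u \<phi> :: "complex \<Rightarrow> complex"
  assume "u holomorphic_on unit_disc \<and> self_map \<phi>"
  then show "let R = ennreal (cmod (u 0) * ln (2 / (1 - (cmod (\<phi> 0))\<^sup>2)))
               + (SUP a\<in>unit_disc. alpha_fn u \<phi> a) + (SUP a\<in>unit_disc. beta_fn u \<phi> a)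
       in ennreal (1 / 5000) * R \<le> wco_norm u \<phi> \<and> wco_norm u \<phi> \<le> ennreal 69 * R"
    using wco_norm_lower_bound wco_norm_upper_bound by (simp add: Let_def)
qed auto

end
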